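(* Let $\mathcal{C}$ be a strict symmetric monoidal category equipped with a partial trace $\mathrm{Tr}$. Then $\mathcal{C}$ can be faithfully embedded in a totally traced category: there exist a totally traced symmetric monoidal category $(\mathcal{D},\widehat{\mathrm{Tr}})$ and a faithful strong symmetric monoidal functor $(F,m):\mathcal{C}\to\mathcal{D}$ that preserves the trace, i.e. for all $f:A\otimes U\to B\otimes U$ in $\mathcal{C}$ such that $\mathrm{Tr}^U_{A,B}(f)$ is defined, $$F(\mathrm{Tr}^U_{A,B}(f))=\widehat{\mathrm{Tr}}^{FU}_{FA,FB}\bigl(m_{B,U}^{-1}\circ F(f)\circ m_{A,U}\bigr).$$
   Context: Here $m_{A,B}:FA\otimes FB\to F(A\otimes B)$ denotes the structure isomorphisms of the strong monoidal functor $F$. For partially defined expressions, $a\simeq b$ (Kleene equality) means that $a,b$ are either both undefined, or both defined and equal; $a\lesssim b$ (directed Kleene equality) means that either $a$ is undefined, or both are defined and equal. A partial trace on a symmetric monoidal category $(\mathcal{C},\otimes,I,\rho,\lambda,\sigma)$ is a family of partial functions $\mathrm{Tr}^U_{X,Y}:\mathcal{C}(X\otimes U,Y\otimes U)\rightharpoonup\mathcal{C}(X,Y)$ satisfying (associativity isomorphisms suppressed): - Naturality: for $f:X\otimes U\to Y\otimes U$, $g:X'\to X$, $h:Y\to Y'$: $h\,\mathrm{Tr}^U_{X,Y}(f)\,g\lesssim \mathrm{Tr}^U_{X',Y'}((h\otimes 1_U)f(g\otimes 1_U))$. - Dinaturality: for $f:X\otimes U\to Y\otimes U'$, $g:U'\to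 U$: $\mathrm{Tr}^U_{X,Y}((1_Y\otimes g)f)\simeq \mathrm{Tr}^{U'}_{X,Y}(f(1_X\otimes g))$. - Vanishing I: for $f:X\otimes I\to Y\otimes I$: $\mathrm{Tr}^I_{X,Y}(f)\simeq\rho_Y f\rho_X^{-1}$ (so it is always defined), where $\rho_X:X\otimes I\to X$. - Vanishing II: for $g:X\otimes U\otimes V\to Y\otimes U\otimes V$, if $\mathrm{Tr}^V_{X\otimes U,Y\otimes U}(g)$ is defined then $\mathrm{Tr}^{U\otimes V}_{X,Y}(g)\simeq\mathrm{Tr}^U_{X,Y}(\mathrm{Tr}^V_{X\otimes U,Y\otimes U}(g))$. - Superposing: for $f:X\otimes U\to Y\otimes U$, $g:W\to Z$: $g\otimes\mathrm{Tr}^U_{X,Y}(f)\lesssim\mathrm{Tr}^U_{W\otimes X,Z\otimes Y}(g\otimes f)$. - Yanking: $\mathrm{Tr}^U_{U,U}(\sigma_{U,U})\simeq 1_U$ (so it is always defined). A partially traced category is a symmetric monoidal category with a partial trace; it is totally traced if all the partial functions $\mathrm{Tr}^U_{X,Y}$ are total. *)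

theory Defs
  imports Main
begin

section \<open>Categories\<close>

text \<open>
  A category has a set of objects and a set of arrows.  The operations are total functions, and
  their values are meaningful only on objects and on composable arrows.  Composition is written
  in the usual order, with \<open>g \<cdot> f\<close> meaning \<open>g\<close> after \<open>f\<close>.
\<close>

record ('o, 'a) category =
  Obj   :: "'o set"
  Arr   :: "'a set"
  Dom   :: "'a \<Rightarrow> 'o"
  Cod   :: "'a \<Rightarrow> 'o"
  Ident :: "'o \<Rightarrow> 'a"  ("\<one>\<index>")
  Comp  :: "'a \<Rightarrow> 'a \<Rightarrow> 'a"  (infixr "\<cdot>\<index>" 55)

definition Hom :: "('o, 'a, 'z) category_scheme \<Rightarrow> 'o \<Rightarrow> 'o \<Rightarrow> 'a set"  ("hom\<index>") where
  "Hom C A B = {f \<in> Arr C. Dom C f = A \<and> Cod C f = B}"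

locale category =
  fixes C :: "('o, 'a, 'z) category_scheme" (structure)
  assumes Dom_Obj: "f \<in> Arr C \<Longrightarrow> Dom C f \<in> Obj C"
    and Cod_Obj: "f \<in> Arr C \<Longrightarrow> Cod C f \<in> Obj C"
    and Ident_hom: "A \<in> Obj C \<Longrightarrow> \<one> A \<in> hom A A"
    and Comp_hom: "f \<in> hom A B \<Longrightarrow> g \<in> hom B D \<Longrightarrow> g \<cdot> f \<in> hom A D"
    and Comp_Ident_left: "f \<in> hom A B \<Longrightarrow> \<one> B \<cdot> f = f"
    and Comp_Ident_right: "f \<in> hom A B \<Longrightarrow> f \<cdot> \<one> A = f"
    and Comp_assoc:
      "f \<in> hom A B \<Longrightarrow> g \<in> hom B D \<Longrightarrow> h \<in> hom D E \<Longrightarrow> (h \<cdot> g) \<cdot> f = h \<cdot> (g \<cdot> f)"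

definition inverse_arrows :: "('o, 'a, 'z) category_scheme \<Rightarrow> 'a \<Rightarrow> 'a \<Rightarrow> bool" where
  "inverse_arrows C f g \<longleftrightarrow>
     f \<in> Arr C \<and> g \<in> hom\<^bsub>C\<^esub> (Cod C f) (Dom C f) \<and>
     g \<cdot>\<^bsub>C\<^esub> f = \<one>\<^bsub>C\<^esub> (Dom C f) \<and> f \<cdot>\<^bsub>C\<^esub> g = \<one>\<^bsub>C\<^esub> (Cod C f)"

definition is_iso :: "('o, 'a, 'z) category_scheme \<Rightarrow> 'a \<Rightarrow> bool" where
  "is_iso C f \<longleftrightarrow> (\<exists>g. inverse_arrows C f g)"

definition inverse_arrow :: "('o, 'a, 'z) category_scheme \<Rightarrow> 'a \<Rightarrow> 'a"  ("inv\<index> _" [81] 80) where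
  "inverse_arrow C f = (THE g. inverse_arrows C f g)"


section \<open>Symmetric monoidal categories\<close>

text \<open>
  The tensor product is \<open>\<otimes>\<close> on objects and \<open>\<odot>\<close> on arrows.  The coherence arrows are
  \<open>\<alpha> A B E : (A \<otimes> B) \<otimes> E \<rightarrow> A \<otimes> (B \<otimes> E)\<close>,
  \<open>\<l> A : \<I> \<otimes> A \<rightarrow> A\<close>, \<open>\<rho> A : A \<otimes> \<I> \<rightarrow> A\<close> and \<open>\<sigma> A B : A \<otimes> B \<rightarrow> B \<otimes> A\<close>.
\<close>

record ('o, 'a) smc = "('o, 'a) category" +
  TensorO :: "'o \<Rightarrow> 'o \<Rightarrow> 'o"  (infixl "\<otimes>\<index>" 70)
  TensorA :: "'a \<Rightarrow> 'a \<Rightarrow> 'a"  (infixl "\<odot>\<index>" 70)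
  Unit    :: "'o"  ("\<I>\<index>")
  Assoc   :: "'o \<Rightarrow> 'o \<Rightarrow> 'o \<Rightarrow> 'a"  ("\<alpha>\<index>")
  LUnit   :: "'o \<Rightarrow> 'a"  ("\<l>\<index>")
  RUnit   :: "'o \<Rightarrow> 'a"  ("\<rho>\<index>")
  Symm    :: "'o \<Rightarrow> 'o \<Rightarrow> 'a"  ("\<sigma>\<index>")

locale symmetric_monoidal_category = category C
  for C :: "('o, 'a, 'z) smc_scheme" (structure) +
  assumes Unit_Obj: "\<I> \<in> Obj C"
    and TensorO_Obj: "A \<in> Obj C \<Longrightarrow> B \<in> Obj C \<Longrightarrow> A \<otimes> B \<in> Obj C"
    and TensorA_hom:
      "f \<in> hom A A' \<Longrightarrow> g \<in> hom B B' \<Longrightarrow> f \<odot> g \<in> hom (A \<otimes> B) (A' \<otimes> B')"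
    and TensorA_Ident: "A \<in> Obj C \<Longrightarrow> B \<in> Obj C \<Longrightarrow> \<one> A \<odot> \<one> B = \<one> (A \<otimes> B)"
    and TensorA_Comp:
      "f \<in> hom A A' \<Longrightarrow> f' \<in> hom A' A'' \<Longrightarrow> g \<in> hom B B' \<Longrightarrow> g' \<in> hom B' B'' \<Longrightarrow>
       (f' \<cdot> f) \<odot> (g' \<cdot> g) = (f' \<odot> g') \<cdot> (f \<odot> g)"
    and Assoc_hom:
      "A \<in> Obj C \<Longrightarrow> B \<in> Obj C \<Longrightarrow> E \<in> Obj C \<Longrightarrow>
       \<alpha> A B E \<in> hom ((A \<otimes> B) \<otimes> E) (A \<otimes> (B \<otimes> E))"
    and Assoc_iso: "A \<in> Obj C \<Longrightarrow> B \<in> Obj C \<Longrightarrow> E \<in> Obj C \<Longrightarrow> is_iso C (\<alpha> A B E)"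
    and Assoc_natural:
      "f \<in> hom A A' \<Longrightarrow> g \<in> hom B B' \<Longrightarrow> h \<in> hom E E' \<Longrightarrow>
       \<alpha> A' B' E' \<cdot> ((f \<odot> g) \<odot> h) = (f \<odot> (g \<odot> h)) \<cdot> \<alpha> A B E"
    and LUnit_hom: "A \<in> Obj C \<Longrightarrow> \<l> A \<in> hom (\<I> \<otimes> A) A"
    and LUnit_iso: "A \<in> Obj C \<Longrightarrow> is_iso C (\<l> A)"
    and LUnit_natural: "f \<in> hom A A' \<Longrightarrow> \<l> A' \<cdot> (\<one> \<I> \<odot> f) = f \<cdot> \<l> A"
    and RUnit_hom: "A \<in> Obj C \<Longrightarrow> \<rho> A \<in> hom (A \<otimes> \<I>) A"
    and RUnit_iso: "A \<in> Obj C \<Longrightarrow> is_iso C (\<rho> A)"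
    and RUnit_natural: "f \<in> hom A A' \<Longrightarrow> \<rho> A' \<cdot> (f \<odot> \<one> \<I>) = f \<cdot> \<rho> A"
    and pentagon:
      "A \<in> Obj C \<Longrightarrow> B \<in> Obj C \<Longrightarrow> E \<in> Obj C \<Longrightarrow> G \<in> Obj C \<Longrightarrow>
       (\<one> A \<odot> \<alpha> B E G) \<cdot> \<alpha> A (B \<otimes> E) G \<cdot> (\<alpha> A B E \<odot> \<one> G) =
       \<alpha> A B (E \<otimes> G) \<cdot> \<alpha> (A \<otimes> B) E G"
    and triangle:
      "A \<in> Obj C \<Longrightarrow> B \<in> Obj C \<Longrightarrow> (\<one> A \<odot> \<l> B) \<cdot> \<alpha> A \<I> B = \<rho> A \<odot> \<one> B"
    and Symm_hom: "A \<in> Obj C \<Longrightarrow> B \<in> Obj C \<Longrightarrow> \<sigma> A B \<in> hom (A \<otimes> B) (B \<otimes> A)"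
    and Symm_natural:
      "f \<in> hom A A' \<Longrightarrow> g \<in> hom B B' \<Longrightarrow> \<sigma> A' B' \<cdot> (f \<odot> g) = (g \<odot> f) \<cdot> \<sigma> A B"
    and Symm_Symm: "A \<in> Obj C \<Longrightarrow> B \<in> Obj C \<Longrightarrow> \<sigma> B A \<cdot> \<sigma> A B = \<one> (A \<otimes> B)"
    and hexagon:
      "A \<in> Obj C \<Longrightarrow> B \<in> Obj C \<Longrightarrow> E \<in> Obj C \<Longrightarrow>
       \<alpha> B E A \<cdot> \<sigma> A (B \<otimes> E) \<cdot> \<alpha> A B E =
       (\<one> B \<odot> \<sigma> A E) \<cdot> \<alpha> B A E \<cdot> (\<sigma> A B \<odot> \<one> E)"

text \<open>
  Strictness concerns associators and unitors only; the symmetry is arbitrary.  That \<open>\<odot>\<close> is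
  strictly associative and unital then follows from the naturality axioms.
\<close>

locale strict_symmetric_monoidal_category = symmetric_monoidal_category +
  assumes TensorO_assoc:
      "A \<in> Obj C \<Longrightarrow> B \<in> Obj C \<Longrightarrow> E \<in> Obj C \<Longrightarrow> (A \<otimes> B) \<otimes> E = A \<otimes> (B \<otimes> E)"
    and TensorO_Unit_left: "A \<in> Obj C \<Longrightarrow> \<I> \<otimes> A = A"
    and TensorO_Unit_right: "A \<in> Obj C \<Longrightarrow> A \<otimes> \<I> = A"
    and Assoc_Ident:
      "A \<in> Obj C \<Longrightarrow> B \<in> Obj C \<Longrightarrow> E \<in> Obj C \<Longrightarrow> \<alpha> A B E = \<one> (A \<otimes> B \<otimes> E)"
    and LUnit_Ident: "A \<in> Obj C \<Longrightarrow> \<l> A = \<one> A"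
    and RUnit_Ident: "A \<in> Obj C \<Longrightarrow> \<rho> A = \<one> A"


section \<open>Partial and total traces\<close>

text \<open>
  Partially defined arrows have type \<^typ>\<open>'a option\<close>, with \<^const>\<open>None\<close> for undefined, so that
  Kleene equality is equality at this type.  An operation on arrows is extended to partially
  defined ones by \<^const>\<open>map_option\<close>.
\<close>

definition kleene_le :: "'a option \<Rightarrow> 'a option \<Rightarrow> bool"  (infix "\<lesssim>" 50) where
  "a \<lesssim> b \<longleftrightarrow> a = None \<or> a = b"

text \<open>
  \<open>Tr X Y U f\<close> is the trace of \<open>f : X \<otimes> U \<rightarrow> Y \<otimes> U\<close> along \<open>U\<close>.  The objects must be given
  because \<open>f\<close> does not determine them.  The first axiom says that \<open>Tr X Y U\<close> is a partial
  function from \<open>hom (X \<otimes> U) (Y \<otimes> U)\<close> to \<open>hom X Y\<close>.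
\<close>

locale partially_traced_category = symmetric_monoidal_category C
  for C :: "('o, 'a, 'z) smc_scheme" (structure) +
  fixes Tr :: "'o \<Rightarrow> 'o \<Rightarrow> 'o \<Rightarrow> 'a \<Rightarrow> 'a option"
  assumes Tr_partial_function:
      "Tr X Y U f = Some t \<Longrightarrow>
       X \<in> Obj C \<and> Y \<in> Obj C \<and> U \<in> Obj C \<and> f \<in> hom (X \<otimes> U) (Y \<otimes> U) \<and> t \<in> hom X Y"
    and naturality:
      "X \<in> Obj C \<Longrightarrow> Y \<in> Obj C \<Longrightarrow> U \<in> Obj C \<Longrightarrow>
       f \<in> hom (X \<otimes> U) (Y \<otimes> U) \<Longrightarrow> g \<in> hom X' X \<Longrightarrow> h \<in> hom Y Y' \<Longrightarrow>
       map_option (\<lambda>t. h \<cdot> t \<cdot> g) (Tr X Y U f)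
         \<lesssim> Tr X' Y' U ((h \<odot> \<one> U) \<cdot> f \<cdot> (g \<odot> \<one> U))"
    and dinaturality:
      "X \<in> Obj C \<Longrightarrow> Y \<in> Obj C \<Longrightarrow> U \<in> Obj C \<Longrightarrow> U' \<in> Obj C \<Longrightarrow>
       f \<in> hom (X \<otimes> U) (Y \<otimes> U') \<Longrightarrow> g \<in> hom U' U \<Longrightarrow>
       Tr X Y U ((\<one> Y \<odot> g) \<cdot> f) = Tr X Y U' (f \<cdot> (\<one> X \<odot> g))"
    and vanishing_I:
      "X \<in> Obj C \<Longrightarrow> Y \<in> Obj C \<Longrightarrow> f \<in> hom (X \<otimes> \<I>) (Y \<otimes> \<I>) \<Longrightarrow>
       Tr X Y \<I> f = Some (\<rho> Y \<cdot> f \<cdot> inv (\<rho> X))"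
    and vanishing_II:
      "X \<in> Obj C \<Longrightarrow> Y \<in> Obj C \<Longrightarrow> U \<in> Obj C \<Longrightarrow> V \<in> Obj C \<Longrightarrow>
       g \<in> hom ((X \<otimes> U) \<otimes> V) ((Y \<otimes> U) \<otimes> V) \<Longrightarrow>
       Tr (X \<otimes> U) (Y \<otimes> U) V g = Some t \<Longrightarrow>
       Tr X Y (U \<otimes> V) (\<alpha> Y U V \<cdot> g \<cdot> inv (\<alpha> X U V)) = Tr X Y U t"
    and superposing:
      "X \<in> Obj C \<Longrightarrow> Y \<in> Obj C \<Longrightarrow> U \<in> Obj C \<Longrightarrow>
       f \<in> hom (X \<otimes> U) (Y \<otimes> U) \<Longrightarrow> g \<in> hom W Z \<Longrightarrow>
       map_option (\<lambda>t. g \<odot> t) (Tr X Y U f)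
         \<lesssim> Tr (W \<otimes> X) (Z \<otimes> Y) U (inv (\<alpha> Z Y U) \<cdot> (g \<odot> f) \<cdot> \<alpha> W X U)"
    and yanking: "U \<in> Obj C \<Longrightarrow> Tr U U U (\<sigma> U U) = Some (\<one> U)"

locale totally_traced_category = partially_traced_category +
  assumes Tr_total:
    "X \<in> Obj C \<Longrightarrow> Y \<in> Obj C \<Longrightarrow> U \<in> Obj C \<Longrightarrow>
     f \<in> hom (X \<otimes> U) (Y \<otimes> U) \<Longrightarrow> Tr X Y U f \<noteq> None"


section \<open>Strong symmetric monoidal functors\<close>

text \<open>
  The functor acts by \<open>FO\<close> on objects and by \<open>FA\<close> on arrows.  Its structure isomorphisms are
  \<open>m A B : FO A \<otimes> FO B \<rightarrow> FO (A \<otimes> B)\<close> and \<open>e : \<I> \<rightarrow> FO \<I>\<close>.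
\<close>

locale strong_symmetric_monoidal_functor =
  C: symmetric_monoidal_category C + D: symmetric_monoidal_category D
  for C :: "('o, 'a, 'y) smc_scheme" and D :: "('p, 'b, 'z) smc_scheme" +
  fixes FO :: "'o \<Rightarrow> 'p" and FA :: "'a \<Rightarrow> 'b" and m :: "'o \<Rightarrow> 'o \<Rightarrow> 'b" and e :: "'b"
  assumes FO_Obj: "A \<in> Obj C \<Longrightarrow> FO A \<in> Obj D"
    and FA_hom: "f \<in> hom\<^bsub>C\<^esub> A B \<Longrightarrow> FA f \<in> hom\<^bsub>D\<^esub> (FO A) (FO B)"
    and FA_Ident: "A \<in> Obj C \<Longrightarrow> FA (\<one>\<^bsub>C\<^esub> A) = \<one>\<^bsub>D\<^esub> (FO A)"
    and FA_Comp: "f \<in> hom\<^bsub>C\<^esub> A B \<Longrightarrow> g \<in> hom\<^bsub>C\<^esub> B E \<Longrightarrow> FA (g \<cdot>\<^bsub>C\<^esub> f) = FA g \<cdot>\<^bsub>D\<^esub> FA f"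
    and m_hom:
      "A \<in> Obj C \<Longrightarrow> B \<in> Obj C \<Longrightarrow> m A B \<in> hom\<^bsub>D\<^esub> (FO A \<otimes>\<^bsub>D\<^esub> FO B) (FO (A \<otimes>\<^bsub>C\<^esub> B))"
    and m_iso: "A \<in> Obj C \<Longrightarrow> B \<in> Obj C \<Longrightarrow> is_iso D (m A B)"
    and m_natural:
      "f \<in> hom\<^bsub>C\<^esub> A A' \<Longrightarrow> g \<in> hom\<^bsub>C\<^esub> B B' \<Longrightarrow>
       m A' B' \<cdot>\<^bsub>D\<^esub> (FA f \<odot>\<^bsub>D\<^esub> FA g) = FA (f \<odot>\<^bsub>C\<^esub> g) \<cdot>\<^bsub>D\<^esub> m A B"
    and e_hom: "e \<in> hom\<^bsub>D\<^esub> \<I>\<^bsub>D\<^esub> (FO \<I>\<^bsub>C\<^esub>)"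
    and e_iso: "is_iso D e"
    and m_Assoc:
      "A \<in> Obj C \<Longrightarrow> B \<in> Obj C \<Longrightarrow> E \<in> Obj C \<Longrightarrow>
       FA (\<alpha>\<^bsub>C\<^esub> A B E) \<cdot>\<^bsub>D\<^esub> m (A \<otimes>\<^bsub>C\<^esub> B) E \<cdot>\<^bsub>D\<^esub> (m A B \<odot>\<^bsub>D\<^esub> \<one>\<^bsub>D\<^esub> (FO E)) =
       m A (B \<otimes>\<^bsub>C\<^esub> E) \<cdot>\<^bsub>D\<^esub> (\<one>\<^bsub>D\<^esub> (FO A) \<odot>\<^bsub>D\<^esub> m B E) \<cdot>\<^bsub>D\<^esub> \<alpha>\<^bsub>D\<^esub> (FO A) (FO B) (FO E)"
    and m_LUnit:
      "A \<in> Obj C \<Longrightarrow>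
       FA (\<l>\<^bsub>C\<^esub> A) \<cdot>\<^bsub>D\<^esub> m \<I>\<^bsub>C\<^esub> A \<cdot>\<^bsub>D\<^esub> (e \<odot>\<^bsub>D\<^esub> \<one>\<^bsub>D\<^esub> (FO A)) = \<l>\<^bsub>D\<^esub> (FO A)"
    and m_RUnit:
      "A \<in> Obj C \<Longrightarrow>
       FA (\<rho>\<^bsub>C\<^esub> A) \<cdot>\<^bsub>D\<^esub> m A \<I>\<^bsub>C\<^esub> \<cdot>\<^bsub>D\<^esub> (\<one>\<^bsub>D\<^esub> (FO A) \<odot>\<^bsub>D\<^esub> e) = \<rho>\<^bsub>D\<^esub> (FO A)"
    and m_Symm:
      "A \<in> Obj C \<Longrightarrow> B \<in> Obj C \<Longrightarrow>
       FA (\<sigma>\<^bsub>C\<^esub> A B) \<cdot>\<^bsub>D\<^esub> m A B = m B A \<cdot>\<^bsub>D\<^esub> \<sigma>\<^bsub>D\<^esub> (FO A) (FO B)"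

definition faithful :: "('o, 'a, 'z) category_scheme \<Rightarrow> ('a \<Rightarrow> 'b) \<Rightarrow> bool" where
  "faithful C FA \<longleftrightarrow> (\<forall>A \<in> Obj C. \<forall>B \<in> Obj C. inj_on FA (hom\<^bsub>C\<^esub> A B))"


section \<open>The types of the ambient category\<close>

text \<open>
  An existential statement cannot quantify over types, so the totally traced category must be
  sought at types built from the types \<^typ>\<open>'o\<close> of objects and \<^typ>\<open>'a\<close> of arrows of the given
  category.  Its objects can be taken from \<^typ>\<open>'o\<close>, and an arrow can be coded as a domain, a
  codomain and an equivalence class of pairs of a hidden object and an arrow.  Only the
  types are fixed here; no structure is prescribed on them.
\<close>

type_synonym ('o, 'a) ambient_arrow = "'o \<times> 'o \<times> ('o \<times> 'a) set"

end

(* An arrow A -> B of the ambient category is an arrow f : A (x) U -> B (x) U of C with a hidden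
   object U, to be thought of as the possibly undefined trace of f along U; so tracing along V merely
   hides V as well.  Such pairs are identified by the equivalence generated by sliding an arrow around
   the hidden loop and by replacing f by its trace along a part of U whenever C has that trace.
   Dinaturality and vanishing II of C say that the trace along the whole hidden object is, up to
   Kleene equality, an invariant of this equivalence.  For arrows with hidden object I it
   is the arrow itself, by vanishing I, which gives faithfulness. *)

theory Submission
  imports Defs
begin

text \<open>The axioms of a partial trace are one-sided: naturality and superposing speak only when
  the smaller trace exists, vanishing II only when the inner one does. Requiring the trace in C
  before a part of the hidden object may be removed means that each axiom is applied just where it
  is available: naturality and superposing make the equivalence a congruence for composition and
  whiskering, and yanking transfers along the embedding. What remains is a matter of order.
  Composition concatenates hidden objects in the order in which the arrows are applied, the new
  trace puts its object in front, and only a last factor can be traced out. Strictness makes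
  concatenation associative and unital on the nose, so a law such as associativity of composition,
  where both sides list the hidden objects in the same order, holds already for representatives.
  Where the orders differ, a symmetry is slid around the loop. The tensor product is assembled from
  whiskering on the left and on the right, which reduces bifunctoriality to a single exchange
  law.\<close>

section \<open>Monoidal calculus\<close>

context category
begin

lemma homD: "f \<in> hom A B \<Longrightarrow> f \<in> Arr C \<and> Dom C f = A \<and> Cod C f = B \<and> A \<in> Obj C \<and> B \<in> Obj C"
  using Dom_Obj Cod_Obj by (auto simp: Hom_def)

lemma homI: "f \<in> Arr C \<Longrightarrow> Dom C f = A \<Longrightarrow> Cod C f = B \<Longrightarrow> f \<in> hom A B"
  by (auto simp: Hom_def)

lemma arr_hom: "f \<in> Arr C \<Longrightarrow> f \<in> hom (Dom C f) (Cod C f)"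
  by (auto simp: Hom_def)

lemma arr_Ident [simp]:
  assumes "A \<in> Obj C"
  shows "\<one> A \<in> Arr C" "Dom C (\<one> A) = A" "Cod C (\<one> A) = A"
  using homD [OF Ident_hom [OF assms]] by auto

lemma arr_Comp [simp]:
  assumes "f \<in> Arr C" "g \<in> Arr C" "Cod C f = Dom C g"
  shows "g \<cdot> f \<in> Arr C" "Dom C (g \<cdot> f) = Dom C f" "Cod C (g \<cdot> f) = Cod C g"
  using homD [OF Comp_hom [of f "Dom C f" "Cod C f" g "Cod C g"]] assms
  by (auto simp: Hom_def)

declare Dom_Obj [simp] Cod_Obj [simp]

lemma Comp_Ident_left' [simp]: "f \<in> Arr C \<Longrightarrow> Cod C f = B \<Longrightarrow> \<one> B \<cdot> f = f"
  using Comp_Ident_left [OF arr_hom] by auto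

lemma Comp_Ident_right' [simp]: "f \<in> Arr C \<Longrightarrow> Dom C f = A \<Longrightarrow> f \<cdot> \<one> A = f"
  using Comp_Ident_right [OF arr_hom] by auto

lemma Comp_assoc' [simp]:
  "f \<in> Arr C \<Longrightarrow> g \<in> Arr C \<Longrightarrow> h \<in> Arr C \<Longrightarrow> Cod C f = Dom C g \<Longrightarrow> Cod C g = Dom C h \<Longrightarrow>
   (h \<cdot> g) \<cdot> f = h \<cdot> (g \<cdot> f)"
  by (rule Comp_assoc [of f "Dom C f" "Cod C f" g "Cod C g" h "Cod C h"]) (auto simp: Hom_def)

lemma inverse_arrow_eqI:
  assumes "f \<in> hom A B" "g \<in> hom B A" "g \<cdot> f = \<one> A" "f \<cdot> g = \<one> B"
  shows "inv f = g"
  unfolding inverse_arrow_def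
proof (rule the_equality)
  show "inverse_arrows C f g"
    using assms by (simp add: inverse_arrows_def Hom_def)
next
  fix h assume "inverse_arrows C f h"
  then have h: "h \<in> Arr C" "Dom C h = B" "Cod C h = A" "h \<cdot> f = \<one> A"
    using assms(1) by (auto simp: inverse_arrows_def Hom_def)
  have f: "f \<in> Arr C" "Dom C f = A" "Cod C f = B" and g: "g \<in> Arr C" "Dom C g = B" "Cod C g = A"
    using assms(1,2) by (auto simp: Hom_def)
  have "h = (h \<cdot> f) \<cdot> g"
    using h(1-3) f g assms(4) by simp
  then show "h = g"
    using h f g by auto
qed

lemma inverse_Ident [simp]: "A \<in> Obj C \<Longrightarrow> inv (\<one> A) = \<one> A"
  by (rule inverse_arrow_eqI [of _ A A]) (auto simp: Ident_hom)

lemma is_iso_Ident: "A \<in> Obj C \<Longrightarrow> is_iso C (\<one> A)"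
  unfolding is_iso_def inverse_arrows_def by (auto intro!: exI [of _ "\<one> A"] simp: Ident_hom)

end

context symmetric_monoidal_category
begin

declare Unit_Obj [simp] TensorO_Obj [simp]

lemma arr_TensorA [simp]:
  assumes "f \<in> Arr C" "g \<in> Arr C"
  shows "f \<odot> g \<in> Arr C" "Dom C (f \<odot> g) = Dom C f \<otimes> Dom C g"
    "Cod C (f \<odot> g) = Cod C f \<otimes> Cod C g"
  using homD [OF TensorA_hom [OF arr_hom [OF assms(1)] arr_hom [OF assms(2)]]] by auto

lemma arr_Symm [simp]:
  assumes "A \<in> Obj C" "B \<in> Obj C"
  shows "\<sigma> A B \<in> Arr C" "Dom C (\<sigma> A B) = A \<otimes> B" "Cod C (\<sigma> A B) = B \<otimes> A"
  using homD [OF Symm_hom [OF assms]] by auto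

lemma Ident_TensorA [simp]: "A \<in> Obj C \<Longrightarrow> B \<in> Obj C \<Longrightarrow> \<one> A \<odot> \<one> B = \<one> (A \<otimes> B)"
  by (rule TensorA_Ident)

lemma TensorA_Comp':
  "f \<in> Arr C \<Longrightarrow> f' \<in> Arr C \<Longrightarrow> g \<in> Arr C \<Longrightarrow> g' \<in> Arr C \<Longrightarrow>
   Cod C f = Dom C f' \<Longrightarrow> Cod C g = Dom C g' \<Longrightarrow>
   (f' \<odot> g') \<cdot> (f \<odot> g) = (f' \<cdot> f) \<odot> (g' \<cdot> g)"
  by (rule TensorA_Comp [symmetric]) (auto simp: Hom_def)

lemma whisker_left_Comp:
  "f \<in> Arr C \<Longrightarrow> g \<in> Arr C \<Longrightarrow> Cod C f = Dom C g \<Longrightarrow> A \<in> Obj C \<Longrightarrow>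
   \<one> A \<odot> (g \<cdot> f) = (\<one> A \<odot> g) \<cdot> (\<one> A \<odot> f)"
  by (simp add: TensorA_Comp')

lemma whisker_right_Comp:
  "f \<in> Arr C \<Longrightarrow> g \<in> Arr C \<Longrightarrow> Cod C f = Dom C g \<Longrightarrow> A \<in> Obj C \<Longrightarrow>
   (g \<cdot> f) \<odot> \<one> A = (g \<odot> \<one> A) \<cdot> (f \<odot> \<one> A)"
  by (simp add: TensorA_Comp')

lemma whisker_exchange:
  assumes "f \<in> Arr C" "g \<in> Arr C" "Dom C f = A" "Cod C f = A'" "Dom C g = B" "Cod C g = B'"
  shows "(f \<odot> \<one> B') \<cdot> (\<one> A \<odot> g) = (\<one> A' \<odot> g) \<cdot> (f \<odot> \<one> B)"
  using assms by (auto simp: TensorA_Comp')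

lemma Symm_natural':
  "f \<in> Arr C \<Longrightarrow> g \<in> Arr C \<Longrightarrow> Cod C f = A' \<Longrightarrow> Cod C g = B' \<Longrightarrow> Dom C f = A \<Longrightarrow> Dom C g = B \<Longrightarrow>
   \<sigma> A' B' \<cdot> (f \<odot> g) = (g \<odot> f) \<cdot> \<sigma> A B"
  by (rule Symm_natural) (auto simp: Hom_def)

end

section \<open>Strict symmetric monoidal calculus: crossings, and wires running past an
  arrow\<close>

context strict_symmetric_monoidal_category
begin

declare TensorO_assoc [simp] TensorO_Unit_left [simp] TensorO_Unit_right [simp]
  Assoc_Ident [simp] LUnit_Ident [simp] RUnit_Ident [simp]

lemma TensorA_assoc [simp]:
  assumes "f \<in> Arr C" "g \<in> Arr C" "h \<in> Arr C"
  shows "(f \<odot> g) \<odot> h = f \<odot> (g \<odot> h)"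
  using Assoc_natural [OF arr_hom [OF assms(1)] arr_hom [OF assms(2)] arr_hom [OF assms(3)]] assms
  by simp

lemma TensorA_Unit_left [simp]: "f \<in> Arr C \<Longrightarrow> \<one> \<I> \<odot> f = f"
  using LUnit_natural [OF arr_hom [of f]] by simp

lemma TensorA_Unit_right [simp]: "f \<in> Arr C \<Longrightarrow> f \<odot> \<one> \<I> = f"
  using RUnit_natural [OF arr_hom [of f]] by simp

lemma TensorA_Ident_Ident [simp]:
  "f \<in> Arr C \<Longrightarrow> A \<in> Obj C \<Longrightarrow> B \<in> Obj C \<Longrightarrow> \<one> A \<odot> (\<one> B \<odot> f) = \<one> (A \<otimes> B) \<odot> f"
  by (simp flip: TensorA_assoc)

lemma Symm_TensorO_right:
  assumes "A \<in> Obj C" "B \<in> Obj C" "E \<in> Obj C"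
  shows "\<sigma> A (B \<otimes> E) = (\<one> B \<odot> \<sigma> A E) \<cdot> (\<sigma> A B \<odot> \<one> E)"
  using hexagon [OF assms] assms by simp

text \<open>The mirror image of the hexagon needs an argument: by the hexagon itself, the right-hand
  side is cancelled by \<open>\<sigma> E (A \<otimes> B)\<close>, whose inverse is the left-hand
  side.\<close>

lemma Symm_TensorO_left:
  assumes [simp]: "A \<in> Obj C" "B \<in> Obj C" "E \<in> Obj C"
  shows "\<sigma> (A \<otimes> B) E = (\<sigma> A E \<odot> \<one> B) \<cdot> (\<one> A \<odot> \<sigma> B E)"
proof -
  let ?s = "\<sigma> (A \<otimes> B) E" and ?u = "\<sigma> E (A \<otimes> B)"
    and ?t = "(\<sigma> A E \<odot> \<one> B) \<cdot> (\<one> A \<odot> \<sigma> B E)"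
  have "?u \<cdot> ?t = (\<one> A \<odot> \<sigma> E B) \<cdot> ((\<sigma> E A \<odot> \<one> B) \<cdot> (\<sigma> A E \<odot> \<one> B)) \<cdot> (\<one> A \<odot> \<sigma> B E)"
    by (simp add: Symm_TensorO_right)
  also have "\<dots> = \<one> (A \<otimes> B \<otimes> E)"
    by (simp add: TensorA_Comp' Symm_Symm)
  finally have *: "?u \<cdot> ?t = \<one> (A \<otimes> B \<otimes> E)" .
  have "?t = (?s \<cdot> ?u) \<cdot> ?t"
    by (subst Symm_Symm) simp_all
  also have "\<dots> = ?s \<cdot> (?u \<cdot> ?t)"
    by (rule Comp_assoc') simp_all
  also have "\<dots> = ?s"
    by (simp add: *)
  finally show ?thesis ..
qed

text \<open>The hexagon at \<open>A\<close>, \<open>\<I>\<close>, \<open>\<I>\<close> makes this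
  symmetry idempotent, and an invertible idempotent is an identity.\<close>

lemma Symm_Unit_right [simp]:
  assumes [simp]: "A \<in> Obj C"
  shows "\<sigma> A \<I> = \<one> A"
proof -
  have 1: "\<sigma> A \<I> = \<sigma> A \<I> \<cdot> \<sigma> A \<I>"
    using Symm_TensorO_right [of A \<I> \<I>] by simp
  have "\<one> A = \<sigma> \<I> A \<cdot> \<sigma> A \<I>"
    by (simp add: Symm_Symm)
  also have "\<dots> = \<sigma> \<I> A \<cdot> \<sigma> A \<I> \<cdot> \<sigma> A \<I>"
    by (simp flip: 1)
  also have "\<dots> = (\<sigma> \<I> A \<cdot> \<sigma> A \<I>) \<cdot> \<sigma> A \<I>"
    by simp
  also have "\<dots> = \<sigma> A \<I>"
    by (simp add: Symm_Symm del: Comp_assoc')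
  finally show ?thesis ..
qed

lemma Symm_Unit_left [simp]: "A \<in> Obj C \<Longrightarrow> \<sigma> \<I> A = \<one> A"
  using Symm_Symm [of A \<I>] by simp

text \<open>The arrow \<open>f : A \<otimes> U \<rightarrow> B \<otimes> U'\<close> with a wire \<open>V\<close> passing between the two factors.\<close>

definition bypass where
  "bypass A B U U' V f = (\<sigma> V B \<odot> \<one> U') \<cdot> (\<one> V \<odot> f) \<cdot> (\<sigma> A V \<odot> \<one> U)"

lemma arr_bypass [simp]:
  assumes "f \<in> Arr C" "Dom C f = A \<otimes> U" "Cod C f = B \<otimes> U'"
    "A \<in> Obj C" "B \<in> Obj C" "U \<in> Obj C" "U' \<in> Obj C" "V \<in> Obj C"
  shows "bypass A B U U' V f \<in> Arr C" "Dom C (bypass A B U U' V f) = A \<otimes> V \<otimes> U"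
    "Cod C (bypass A B U U' V f) = B \<otimes> V \<otimes> U'"
  using assms by (simp_all add: bypass_def)

lemma Symm_Symm_whisker:
  assumes [simp]: "A \<in> Obj C" "B \<in> Obj C" "E \<in> Obj C"
  shows "(\<sigma> B A \<odot> \<one> E) \<cdot> (\<sigma> A B \<odot> \<one> E) = \<one> (A \<otimes> B \<otimes> E)"
    "(\<one> E \<odot> \<sigma> B A) \<cdot> (\<one> E \<odot> \<sigma> A B) = \<one> (E \<otimes> A \<otimes> B)"
  by (simp_all add: TensorA_Comp' Symm_Symm)

text \<open>Composites are normalised to nest to the right, where the pair
  \<open>h \<cdot> g\<close> is no longer a subterm. This lifts an equation for the pair to one with
  a further factor behind it.\<close>

lemma Comp_cancel_middle:
  "f \<in> Arr C \<Longrightarrow> g \<in> Arr C \<Longrightarrow> h \<in> Arr C \<Longrightarrow> Cod C f = Dom C g \<Longrightarrow> Cod C g = Dom C h \<Longrightarrow>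
   h \<cdot> g = k \<Longrightarrow> h \<cdot> (g \<cdot> f) = k \<cdot> f"
  using Comp_assoc' by auto

lemma Symm_Symm_whisker_Comp:
  assumes "A \<in> Obj C" "B \<in> Obj C" "E \<in> Obj C" "f \<in> Arr C"
  shows "Cod C f = A \<otimes> B \<otimes> E \<Longrightarrow> (\<sigma> B A \<odot> \<one> E) \<cdot> (\<sigma> A B \<odot> \<one> E) \<cdot> f = f"
    "Cod C f = E \<otimes> A \<otimes> B \<Longrightarrow> (\<one> E \<odot> \<sigma> B A) \<cdot> (\<one> E \<odot> \<sigma> A B) \<cdot> f = f"
  using assms by (simp_all add: Comp_cancel_middle [OF _ _ _ _ _ Symm_Symm_whisker(1)]
    Comp_cancel_middle [OF _ _ _ _ _ Symm_Symm_whisker(2)])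

lemma bypass_Comp:
  assumes [simp]: "f \<in> Arr C" "Dom C f = A \<otimes> U" "Cod C f = B \<otimes> U'" "g \<in> Arr C"
    "Dom C g = B \<otimes> U'" "Cod C g = E \<otimes> U''"
    "A \<in> Obj C" "B \<in> Obj C" "E \<in> Obj C" "U \<in> Obj C" "U' \<in> Obj C" "U'' \<in> Obj C" "V \<in> Obj C"
  shows "bypass A E U U'' V (g \<cdot> f) = bypass B E U' U'' V g \<cdot> bypass A B U U' V f"
  by (simp add: bypass_def whisker_left_Comp Symm_Symm_whisker_Comp)

lemma bypass_Unit:
  assumes [simp]: "f \<in> Arr C" "Dom C f = A \<otimes> U" "Cod C f = B \<otimes> U'"
    "A \<in> Obj C" "B \<in> Obj C" "U \<in> Obj C" "U' \<in> Obj C"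
  shows "bypass A B U U' \<I> f = f"
  by (simp add: bypass_def)

text \<open>\<open>bypass_def\<close> crosses the wire with visible objects only, so hidden factors
  may be regrouped freely and the two crossings merge by the hexagons. The later wire lands to the
  left of the earlier one.\<close>

lemma bypass_TensorO_inner:
  assumes [simp]: "f \<in> Arr C" "Dom C f = A \<otimes> W" "Cod C f = B \<otimes> W'"
    "A \<in> Obj C" "B \<in> Obj C" "U \<in> Obj C" "V \<in> Obj C" "W \<in> Obj C" "W' \<in> Obj C"
  shows "bypass A B (V \<otimes> W) (V \<otimes> W') U (bypass A B W W' V f) = bypass A B W W' (U \<otimes> V) f"
  by (simp add: bypass_def whisker_left_Comp whisker_right_Comp Symm_TensorO_left Symm_TensorO_right)

text \<open>Naturality of the symmetry at \<open>f\<close> carries the wire from one side of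
  \<open>f\<close> to the other: instead of going around the visible objects it goes around the
  hidden ones. The two forms complement each other, each being convenient when the objects that it
  does not cross are regrouped.\<close>

lemma bypass_eq_right:
  assumes [simp]: "f \<in> Arr C" "Dom C f = A \<otimes> U" "Cod C f = B \<otimes> U'"
    "A \<in> Obj C" "B \<in> Obj C" "U \<in> Obj C" "U' \<in> Obj C" "V \<in> Obj C"
  shows "bypass A B U U' V f = (\<one> B \<odot> \<sigma> U' V) \<cdot> (f \<odot> \<one> V) \<cdot> (\<one> A \<odot> \<sigma> V U)"
proof -
  have 1: "(\<one> B \<odot> \<sigma> V U') \<cdot> (\<sigma> V B \<odot> \<one> U') = \<sigma> V (B \<otimes> U')"
    by (simp add: Symm_TensorO_right)
  have 2: "(\<sigma> V A \<odot> \<one> U) \<cdot> (\<sigma> A V \<odot> \<one> U) = \<one> (A \<otimes> V \<otimes> U)"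
    by (rule Symm_Symm_whisker) simp_all
  have "bypass A B U U' V f = (\<one> B \<odot> \<sigma> U' V) \<cdot> (\<one> B \<odot> \<sigma> V U') \<cdot> bypass A B U U' V f"
    by (rule Symm_Symm_whisker_Comp(2) [symmetric]) simp_all
  also have "\<dots> = (\<one> B \<odot> \<sigma> U' V) \<cdot> (\<sigma> V (B \<otimes> U') \<cdot> (\<one> V \<odot> f)) \<cdot> (\<sigma> A V \<odot> \<one> U)"
    by (simp add: bypass_def Symm_TensorO_right)
  also have "\<sigma> V (B \<otimes> U') \<cdot> (\<one> V \<odot> f) = (f \<odot> \<one> V) \<cdot> \<sigma> V (A \<otimes> U)"
    by (rule Symm_natural') simp_all
  also have "(\<one> B \<odot> \<sigma> U' V) \<cdot> ((f \<odot> \<one> V) \<cdot> \<sigma> V (A \<otimes> U)) \<cdot> (\<sigma> A V \<odot> \<one> U) =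
      (\<one> B \<odot> \<sigma> U' V) \<cdot> (f \<odot> \<one> V) \<cdot> (\<one> A \<odot> \<sigma> V U)"
    by (simp add: Symm_TensorO_right 2)
  finally show ?thesis .
qed

text \<open>Here the visible factor grows, so the form that crosses only hidden objects is the
  suitable one. The later wire lands to the right of the earlier one.\<close>

lemma bypass_TensorO_outer:
  assumes [simp]: "f \<in> Arr C" "Dom C f = A \<otimes> W" "Cod C f = B \<otimes> W'"
    "A \<in> Obj C" "B \<in> Obj C" "U \<in> Obj C" "V \<in> Obj C" "W \<in> Obj C" "W' \<in> Obj C"
  shows "bypass (A \<otimes> U) (B \<otimes> U) W W' V (bypass A B W W' U f) = bypass A B W W' (U \<otimes> V) f"
  by (simp add: bypass_eq_right whisker_left_Comp whisker_right_Comp Symm_TensorO_left Symm_TensorO_right)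

text \<open>Anything on the passing wire may act before or after \<open>f\<close>. This serves both
  for sliding an arrow around the loop of a composite and, with \<open>k\<close> a whole
  representative, for the exchange law.\<close>

lemma bypass_natural:
  assumes [simp]: "f \<in> Arr C" "Dom C f = A \<otimes> U" "Cod C f = B \<otimes> U'"
    "A \<in> Obj C" "B \<in> Obj C" "U \<in> Obj C" "U' \<in> Obj C" "k \<in> Arr C" "Dom C k = V" "Cod C k = V'"
    "V \<in> Obj C" "V' \<in> Obj C"
  shows "bypass A B U U' V' f \<cdot> (\<one> A \<odot> (k \<odot> \<one> U)) = (\<one> B \<odot> (k \<odot> \<one> U')) \<cdot> bypass A B U U' V f"
proof -
  have 1: "(\<sigma> A V' \<odot> \<one> U) \<cdot> (\<one> A \<odot> (k \<odot> \<one> U)) = (k \<odot> \<one> (A \<otimes> U)) \<cdot> (\<sigma> A V \<odot> \<one> U)"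
    using Symm_natural' [of "\<one> A" k A V' A V]
    by (simp add: TensorA_Comp' flip: TensorA_assoc Ident_TensorA)
  have 2: "(\<sigma> V' B \<odot> \<one> U') \<cdot> (k \<odot> \<one> (B \<otimes> U')) = (\<one> B \<odot> (k \<odot> \<one> U')) \<cdot> (\<sigma> V B \<odot> \<one> U')"
    using Symm_natural' [of k "\<one> B" V' B V B]
    by (simp add: TensorA_Comp' flip: TensorA_assoc Ident_TensorA)
  have 3: "(\<one> V' \<odot> f) \<cdot> (k \<odot> \<one> (A \<otimes> U)) = (k \<odot> \<one> (B \<otimes> U')) \<cdot> (\<one> V \<odot> f)"
    by (simp add: TensorA_Comp')
  show ?thesis
    by (simp add: bypass_def 1 Comp_cancel_middle [OF _ _ _ _ _ 2] Comp_cancel_middle [OF _ _ _ _ _ 3])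
qed

lemma bypass_whisker_left:
  assumes [simp]: "g \<in> Arr C" "Dom C g = U \<otimes> W" "Cod C g = U' \<otimes> W'"
    "U \<in> Obj C" "U' \<in> Obj C" "W \<in> Obj C" "W' \<in> Obj C" "V \<in> Obj C" "Y \<in> Obj C"
  shows "bypass (Y \<otimes> U) (Y \<otimes> U') W W' V (\<one> Y \<odot> g) = \<one> Y \<odot> bypass U U' W W' V g"
  by (simp add: bypass_eq_right whisker_left_Comp)

lemma bypass_whisker_right:
  assumes [simp]: "g \<in> Arr C" "Dom C g = A \<otimes> U" "Cod C g = B \<otimes> U'"
    "A \<in> Obj C" "B \<in> Obj C" "U \<in> Obj C" "U' \<in> Obj C" "V \<in> Obj C" "W \<in> Obj C"
  shows "bypass A B (U \<otimes> W) (U' \<otimes> W) V (g \<odot> \<one> W) = bypass A B U U' V g \<odot> \<one> W"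
  by (simp add: bypass_def whisker_right_Comp)

lemma bypass_pure_right:
  assumes [simp]: "k \<in> Arr C" "Dom C k = U" "Cod C k = U'" "A \<in> Obj C" "V \<in> Obj C" "U \<in> Obj C" "U' \<in> Obj C"
  shows "bypass A A U U' V (\<one> A \<odot> k) = \<one> (A \<otimes> V) \<odot> k"
proof -
  have "bypass A A U U' V (\<one> A \<odot> k) = (\<sigma> V A \<odot> \<one> U') \<cdot> (\<one> (V \<otimes> A) \<odot> k) \<cdot> (\<sigma> A V \<odot> \<one> U)"
    by (simp add: bypass_def)
  also have "\<dots> = \<one> (A \<otimes> V) \<odot> k"
    by (simp add: whisker_exchange [of "\<sigma> A V" k "A \<otimes> V" "V \<otimes> A" U U', symmetric]
        Symm_Symm_whisker_Comp)
  finally show ?thesis .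
qed

lemma bypass_pure_left:
  assumes [simp]: "f \<in> Arr C" "Dom C f = A" "Cod C f = B" "A \<in> Obj C" "B \<in> Obj C" "V \<in> Obj C"
  shows "bypass A B \<I> \<I> V f = f \<odot> \<one> V"
  by (simp add: bypass_eq_right)

text \<open>Shifting the border between visible and hidden across \<open>U\<close> changes the side
  of \<open>U\<close> on which the wire \<open>G\<close> runs; the outer symmetries repair this.
  Tracing along \<open>U\<close> shifts the border in just this way.\<close>

lemma bypass_regroup:
  assumes [simp]: "f \<in> Arr C" "Dom C f = X \<otimes> U \<otimes> V" "Cod C f = Y \<otimes> U' \<otimes> V'"
    "X \<in> Obj C" "Y \<in> Obj C" "U \<in> Obj C" "U' \<in> Obj C" "V \<in> Obj C" "V' \<in> Obj C" "G \<in> Obj C"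
  shows "bypass (X \<otimes> U) (Y \<otimes> U') V V' G f =
    (\<one> Y \<odot> (\<sigma> G U' \<odot> \<one> V')) \<cdot> bypass X Y (U \<otimes> V) (U' \<otimes> V') G f \<cdot> (\<one> X \<odot> (\<sigma> U G \<odot> \<one> V))"
  by (simp add: bypass_def whisker_left_Comp whisker_right_Comp Symm_TensorO_left Symm_TensorO_right)

end

section \<open>Equivalence of arrows with a hidden object\<close>

locale strict_partially_traced =
  strict_symmetric_monoidal_category C + partially_traced_category C Tr
  for C :: "('o, 'a) smc" (structure) and Tr :: "'o \<Rightarrow> 'o \<Rightarrow> 'o \<Rightarrow> 'a \<Rightarrow> 'a option"
begin

lemma Tr_hom:
  assumes "Tr X Y U f = Some t"
  shows "t \<in> Arr C" "Dom C t = X" "Cod C t = Y"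
  using Tr_partial_function [OF assms] by (auto simp: Hom_def)

lemma Tr_Comp:
  assumes "Tr X Y U f = Some t"
    and [simp]: "f \<in> Arr C" "Dom C f = X \<otimes> U" "Cod C f = Y \<otimes> U" "X \<in> Obj C" "Y \<in> Obj C" "U \<in> Obj C"
      "g \<in> Arr C" "Dom C g = X'" "Cod C g = X" "h \<in> Arr C" "Dom C h = Y" "Cod C h = Y'"
  shows "Tr X' Y' U ((h \<odot> \<one> U) \<cdot> f \<cdot> (g \<odot> \<one> U)) = Some (h \<cdot> t \<cdot> g)"
  using naturality [of X Y U f g X' h Y'] assms(1) by (simp add: kleene_le_def homI)

lemma Tr_whisker_left:
  assumes "Tr X Y U f = Some t"
    and [simp]: "f \<in> Arr C" "Dom C f = X \<otimes> U" "Cod C f = Y \<otimes> U" "X \<in> Obj C" "Y \<in> Obj C" "U \<in> Obj C"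
      "W \<in> Obj C"
  shows "Tr (W \<otimes> X) (W \<otimes> Y) U (\<one> W \<odot> f) = Some (\<one> W \<odot> t)"
  using superposing [of X Y U f "\<one> W" W W] assms(1) by (simp add: kleene_le_def homI)

text \<open>A bypass is a whiskering between two crossings that do not touch \<open>V\<close>, so
  superposing and naturality transport the defined trace through it.\<close>

lemma Tr_bypass:
  assumes t: "Tr (A \<otimes> U) (B \<otimes> U') V f = Some t"
    and [simp]: "f \<in> Arr C" "Dom C f = A \<otimes> U \<otimes> V" "Cod C f = B \<otimes> U' \<otimes> V" "A \<in> Obj C" "B \<in> Obj C"
      "U \<in> Obj C" "U' \<in> Obj C" "V \<in> Obj C" "W \<in> Obj C"
  shows "Tr (A \<otimes> W \<otimes> U) (B \<otimes> W \<otimes> U') V (bypass A B (U \<otimes> V) (U' \<otimes> V) W f) =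
    Some (bypass A B U U' W t)"
proof -
  have "Tr (A \<otimes> W \<otimes> U) (B \<otimes> W \<otimes> U') V
      (((\<sigma> W B \<odot> \<one> U') \<odot> \<one> V) \<cdot> (\<one> W \<odot> f) \<cdot> ((\<sigma> A W \<odot> \<one> U) \<odot> \<one> V)) =
    Some ((\<sigma> W B \<odot> \<one> U') \<cdot> (\<one> W \<odot> t) \<cdot> (\<sigma> A W \<odot> \<one> U))"
    by (rule Tr_Comp [OF Tr_whisker_left [OF t]]) simp_all
  then show ?thesis
    by (simp add: bypass_def)
qed

text \<open>In \<open>hide\<close> only a final factor is traced out; other factors are first moved
  to the end by a symmetry. The rule \<open>refl\<close> applies to arbitrary pairs, and being an
  endomorphism on the hidden factor is tracked separately by \<open>representative\<close>.\<close>

inductive trace_equiv :: "'o \<Rightarrow> 'o \<Rightarrow> 'o \<times> 'a \<Rightarrow> 'o \<times> 'a \<Rightarrow> bool" for A B where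
  slide: "U \<in> Obj C \<Longrightarrow> U' \<in> Obj C \<Longrightarrow> f \<in> hom (A \<otimes> U) (B \<otimes> U') \<Longrightarrow> k \<in> hom U' U \<Longrightarrow>
    trace_equiv A B (U, (\<one> B \<odot> k) \<cdot> f) (U', f \<cdot> (\<one> A \<odot> k))"
| hide: "U \<in> Obj C \<Longrightarrow> V \<in> Obj C \<Longrightarrow> f \<in> hom (A \<otimes> U \<otimes> V) (B \<otimes> U \<otimes> V) \<Longrightarrow>
    Tr (A \<otimes> U) (B \<otimes> U) V f = Some t \<Longrightarrow> trace_equiv A B (U \<otimes> V, f) (U, t)"
| refl: "trace_equiv A B x x"
| sym: "trace_equiv A B x y \<Longrightarrow> trace_equiv A B y x"
| trans: "trace_equiv A B x y \<Longrightarrow> trace_equiv A B y z \<Longrightarrow> trace_equiv A B x z"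

text \<open>Vanishing II is conditional, but its condition is exactly the premise of
  \<open>hide\<close>. The equation is between options, so the whole trace may well be undefined on
  both sides.\<close>

lemma trace_equiv_Tr:
  assumes "trace_equiv A B x y" and [simp]: "A \<in> Obj C" "B \<in> Obj C"
  shows "Tr A B (fst x) (snd x) = Tr A B (fst y) (snd y)"
  using assms(1)
proof induction
  case (slide U U' f k)
  then show ?case
    by (auto intro: dinaturality)
next
  case (hide U V f t)
  then show ?case
    using vanishing_II [of A B U V f t] homD [OF hide(3)] by simp
qed simp_all

definition representative :: "'o \<Rightarrow> 'o \<Rightarrow> 'o \<times> 'a \<Rightarrow> bool" where
  "representative A B x \<longleftrightarrow> fst x \<in> Obj C \<and> snd x \<in> Arr C \<and> Dom C (snd x) = A \<otimes> fst x \<and> Cod C (snd x) = B \<otimes> fst x"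

lemma representative_Pair [simp]:
  "representative A B (U, f) \<longleftrightarrow> U \<in> Obj C \<and> f \<in> Arr C \<and> Dom C f = A \<otimes> U \<and> Cod C f = B \<otimes> U"
  by (simp add: representative_def)

text \<open>In the congruence proofs, \<open>sym\<close> and \<open>trans\<close> pass through pairs
  about which nothing is assumed; this equivalence supplies their typing, in both
  directions.\<close>

lemma trace_equiv_representative:
  assumes "trace_equiv A B x y" and [simp]: "A \<in> Obj C" "B \<in> Obj C"
  shows "representative A B x \<longleftrightarrow> representative A B y"
  using assms(1)
proof induction
  case (slide U U' f k)
  then show ?case
    by (auto dest!: homD)
next
  case (hide U V f t)
  then show ?case
    by (auto dest!: homD Tr_partial_function)
qed simp_all

lemma trace_equiv_slide:
  assumes "f \<in> Arr C" "Dom C f = A \<otimes> U" "Cod C f = B \<otimes> U'" "k \<in> Arr C" "Dom C k = U'" "Cod C k = U"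
    "U \<in> Obj C" "U' \<in> Obj C"
  shows "trace_equiv A B (U, (\<one> B \<odot> k) \<cdot> f) (U', f \<cdot> (\<one> A \<odot> k))"
  by (rule slide) (use assms in \<open>auto intro: homI\<close>)

text \<open>Renaming the hidden object along an isomorphism is an instance of sliding.\<close>

lemma trace_equiv_conjugate:
  assumes [simp]: "f \<in> Arr C" "Dom C f = A \<otimes> U" "Cod C f = B \<otimes> U"
      "k \<in> Arr C" "Dom C k = U" "Cod C k = U'" "k' \<in> Arr C" "Dom C k' = U'" "Cod C k' = U"
      "A \<in> Obj C" "B \<in> Obj C" "U \<in> Obj C" "U' \<in> Obj C"
    and "k' \<cdot> k = \<one> U"
  shows "trace_equiv A B (U, f) (U', (\<one> B \<odot> k) \<cdot> f \<cdot> (\<one> A \<odot> k'))"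
proof -
  have "trace_equiv A B (U', (\<one> B \<odot> k) \<cdot> (f \<cdot> (\<one> A \<odot> k'))) (U, (f \<cdot> (\<one> A \<odot> k')) \<cdot> (\<one> A \<odot> k))"
    by (rule trace_equiv_slide) simp_all
  then have "trace_equiv A B (U', (\<one> B \<odot> k) \<cdot> (f \<cdot> (\<one> A \<odot> k'))) (U, f)"
    by (simp add: TensorA_Comp' assms(14))
  then show ?thesis
    by (rule trace_equiv.sym)
qed

text \<open>In a totally traced category, the composite of the trace of \<open>g\<close> along
  \<open>V\<close> with the trace of \<open>f\<close> along \<open>U\<close> equals the trace of
  this arrow along \<open>U \<otimes> V\<close>. That identity is taken as the definition of
  composition.\<close>

definition hcomp where
  "hcomp A B E y x = (fst x \<otimes> fst y, bypass B E (fst y) (fst y) (fst x) (snd y) \<cdot> (snd x \<odot> \<one> (fst y)))"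

lemma hcomp_Pair [simp]:
  "hcomp A B E (V, g) (U, f) = (U \<otimes> V, bypass B E V V U g \<cdot> (f \<odot> \<one> V))"
  by (simp add: hcomp_def)

text \<open>The hidden object of \<open>y\<close> stands last in the composite, so a slide or a
  removal inside it remains one of the same kind; naturality with respect to \<open>f\<close>
  handles the removal.\<close>

lemma trace_equiv_hcomp_left:
  assumes "trace_equiv B E y y'" "representative B E y" "representative A B x"
    and [simp]: "A \<in> Obj C" "B \<in> Obj C" "E \<in> Obj C"
  shows "trace_equiv A E (hcomp A B E y x) (hcomp A B E y' x)"
  using assms(1,2)
proof induction
  case (slide V V' g k)
  obtain U f where x: "x = (U, f)"
    by (cases x)
  have [simp]: "U \<in> Obj C" "f \<in> Arr C" "Dom C f = A \<otimes> U" "Cod C f = B \<otimes> U"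
    using assms(3) by (simp_all add: x)
  have [simp]: "V \<in> Obj C" "V' \<in> Obj C" "g \<in> Arr C" "Dom C g = B \<otimes> V" "Cod C g = E \<otimes> V'"
    "k \<in> Arr C" "Dom C k = V'" "Cod C k = V"
    using slide by (auto dest: homD)
  have "trace_equiv A E (U \<otimes> V, (\<one> E \<odot> (\<one> U \<odot> k)) \<cdot> (bypass B E V V' U g \<cdot> (f \<odot> \<one> V)))
     (U \<otimes> V', (bypass B E V V' U g \<cdot> (f \<odot> \<one> V)) \<cdot> (\<one> A \<odot> (\<one> U \<odot> k)))"
    by (rule trace_equiv_slide) simp_all
  moreover have "bypass B E V V U ((\<one> E \<odot> k) \<cdot> g) = (\<one> E \<odot> (\<one> U \<odot> k)) \<cdot> bypass B E V V' U g"
    by (subst bypass_Comp [where U' = V' and B = E]) (simp_all add: bypass_pure_right)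
  moreover have "bypass B E V' V' U (g \<cdot> (\<one> B \<odot> k)) = bypass B E V V' U g \<cdot> (\<one> B \<odot> (\<one> U \<odot> k))"
    by (subst bypass_Comp [where U' = V and B = B]) (simp_all add: bypass_pure_right)
  moreover have "(\<one> (B \<otimes> U) \<odot> k) \<cdot> (f \<odot> \<one> V') = (f \<odot> \<one> V) \<cdot> (\<one> (A \<otimes> U) \<odot> k)"
    by (simp add: TensorA_Comp')
  ultimately show ?case
    by (simp add: x)
next
  case (hide V W g t)
  obtain U f where x: "x = (U, f)"
    by (cases x)
  have [simp]: "U \<in> Obj C" "f \<in> Arr C" "Dom C f = A \<otimes> U" "Cod C f = B \<otimes> U"
    using assms(3) by (simp_all add: x)
  have [simp]: "V \<in> Obj C" "W \<in> Obj C" "g \<in> Arr C" "Dom C g = B \<otimes> V \<otimes> W" "Cod C g = E \<otimes> V \<otimes> W"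
    using hide by (auto dest: homD)
  note [simp] = Tr_hom [OF hide(4)]
  have "Tr (A \<otimes> U \<otimes> V) (E \<otimes> U \<otimes> V) W
      ((\<one> (E \<otimes> U \<otimes> V) \<odot> \<one> W) \<cdot> bypass B E (V \<otimes> W) (V \<otimes> W) U g \<cdot> ((f \<odot> \<one> V) \<odot> \<one> W)) =
      Some (\<one> (E \<otimes> U \<otimes> V) \<cdot> bypass B E V V U t \<cdot> (f \<odot> \<one> V))"
    by (rule Tr_Comp [OF Tr_bypass [OF hide(4)]]) simp_all
  then have "trace_equiv A E ((U \<otimes> V) \<otimes> W, bypass B E (V \<otimes> W) (V \<otimes> W) U g \<cdot> (f \<odot> \<one> (V \<otimes> W)))
      (U \<otimes> V, bypass B E V V U t \<cdot> (f \<odot> \<one> V))"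
    by (intro trace_equiv.hide) (simp_all add: homI)
  then show ?case
    by (simp add: x)
next
  case (refl y)
  show ?case by (rule trace_equiv.refl)
next
  case (sym y z)
  then show ?case
    using trace_equiv_representative trace_equiv.sym by (metis assms(5,6))
next
  case (trans y z w)
  then show ?case
    using trace_equiv_representative trace_equiv.trans by (metis assms(5,6))
qed

text \<open>Now a removable factor \<open>W\<close> of the hidden object of \<open>x\<close> stands
  in front of the hidden object \<open>V\<close> of \<open>y\<close>, so it has to be moved past
  \<open>V\<close> before \<open>hide\<close> applies.\<close>

lemma trace_equiv_hcomp_right:
  assumes "trace_equiv A B x x'" "representative A B x" "representative B E y"
    and [simp]: "A \<in> Obj C" "B \<in> Obj C" "E \<in> Obj C"
  shows "trace_equiv A E (hcomp A B E y x) (hcomp A B E y x')"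
  using assms(1,2)
proof induction
  case (slide U U' f k)
  obtain V g where y: "y = (V, g)"
    by (cases y)
  have [simp]: "V \<in> Obj C" "g \<in> Arr C" "Dom C g = B \<otimes> V" "Cod C g = E \<otimes> V"
    using assms(3) by (simp_all add: y)
  have [simp]: "U \<in> Obj C" "U' \<in> Obj C" "f \<in> Arr C" "Dom C f = A \<otimes> U" "Cod C f = B \<otimes> U'"
    "k \<in> Arr C" "Dom C k = U'" "Cod C k = U"
    using slide by (auto dest: homD)
  have "trace_equiv A E (U \<otimes> V, (\<one> E \<odot> (k \<odot> \<one> V)) \<cdot> (bypass B E V V U' g \<cdot> (f \<odot> \<one> V)))
     (U' \<otimes> V, (bypass B E V V U' g \<cdot> (f \<odot> \<one> V)) \<cdot> (\<one> A \<odot> (k \<odot> \<one> V)))"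
    by (rule trace_equiv_slide) simp_all
  moreover have "bypass B E V V U g \<cdot> (\<one> B \<odot> (k \<odot> \<one> V)) = (\<one> E \<odot> (k \<odot> \<one> V)) \<cdot> bypass B E V V U' g"
    by (rule bypass_natural) simp_all
  ultimately show ?case
    by (simp add: y whisker_right_Comp flip: Comp_assoc')
next
  case (hide U W f t)
  obtain V g where y: "y = (V, g)"
    by (cases y)
  have [simp]: "V \<in> Obj C" "g \<in> Arr C" "Dom C g = B \<otimes> V" "Cod C g = E \<otimes> V"
    using assms(3) by (simp_all add: y)
  have [simp]: "U \<in> Obj C" "W \<in> Obj C" "f \<in> Arr C" "Dom C f = A \<otimes> U \<otimes> W" "Cod C f = B \<otimes> U \<otimes> W"
    using hide by (auto dest: homD)
  note [simp] = Tr_hom [OF hide(4)]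
  let ?s = "\<one> U \<odot> \<sigma> W V" and ?s' = "\<one> U \<odot> \<sigma> V W"
  let ?h = "bypass B E V V (U \<otimes> W) g \<cdot> (f \<odot> \<one> V)"
  have 1: "trace_equiv A E (U \<otimes> W \<otimes> V, ?h) (U \<otimes> V \<otimes> W, (\<one> E \<odot> ?s) \<cdot> ?h \<cdot> (\<one> A \<odot> ?s'))"
    by (rule trace_equiv_conjugate) (simp_all add: Symm_Symm_whisker)
  \<comment> \<open>With \<open>\<I>\<close> as the remaining hidden factor,
    \<open>Tr_bypass\<close> computes the trace of \<open>f\<close> along \<open>W\<close> with
    \<open>V\<close> alongside: it is \<open>t \<odot> \<one> V\<close>.\<close>
  have t': "Tr ((A \<otimes> U) \<otimes> V \<otimes> \<I>) ((B \<otimes> U) \<otimes> V \<otimes> \<I>) W (bypass (A \<otimes> U) (B \<otimes> U) (\<I> \<otimes> W) (\<I> \<otimes> W) V f) =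
      Some (bypass (A \<otimes> U) (B \<otimes> U) \<I> \<I> V t)"
    by (rule Tr_bypass) (simp_all add: hide(4))
  have "Tr (A \<otimes> U \<otimes> V) (E \<otimes> U \<otimes> V) W
      ((bypass B E V V U g \<odot> \<one> W) \<cdot> bypass (A \<otimes> U) (B \<otimes> U) W W V f \<cdot> (\<one> (A \<otimes> U \<otimes> V) \<odot> \<one> W)) =
      Some (bypass B E V V U g \<cdot> (t \<odot> \<one> V) \<cdot> \<one> (A \<otimes> U \<otimes> V))"
    by (rule Tr_Comp) (use t' in \<open>simp_all add: bypass_pure_left\<close>)
  then have 2: "trace_equiv A E ((U \<otimes> V) \<otimes> W, (bypass B E V V U g \<odot> \<one> W) \<cdot> bypass (A \<otimes> U) (B \<otimes> U) W W V f)
      (U \<otimes> V, bypass B E V V U g \<cdot> (t \<odot> \<one> V))"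
    by (intro trace_equiv.hide) (simp_all add: homI)
  \<comment> \<open>After the conjugation \<open>W\<close> runs beside \<open>g\<close> without
    crossing it. The crossings that are left combine with \<open>f \<odot> \<one> V\<close> into a
    bypass of \<open>f\<close> in its right-hand form.\<close>
  have "(\<one> E \<odot> ?s) \<cdot> ?h \<cdot> (\<one> A \<odot> ?s') = ((\<one> (E \<otimes> U) \<odot> \<sigma> W V) \<cdot> bypass B E V V (U \<otimes> W) g) \<cdot> (f \<odot> \<one> V) \<cdot> (\<one> (A \<otimes> U) \<odot> \<sigma> V W)"
    by simp
  also have "bypass B E V V (U \<otimes> W) g = bypass (B \<otimes> U) (E \<otimes> U) V V W (bypass B E V V U g)"
    by (simp add: bypass_TensorO_outer)
  also have "(\<one> (E \<otimes> U) \<odot> \<sigma> W V) \<cdot> \<dots> = (bypass B E V V U g \<odot> \<one> W) \<cdot> (\<one> (B \<otimes> U) \<odot> \<sigma> W V)"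
    by (subst bypass_eq_right) (simp_all add: Symm_Symm_whisker_Comp(2) [of V W "E \<otimes> U", simplified])
  also have "((bypass B E V V U g \<odot> \<one> W) \<cdot> (\<one> (B \<otimes> U) \<odot> \<sigma> W V)) \<cdot> (f \<odot> \<one> V) \<cdot> (\<one> (A \<otimes> U) \<odot> \<sigma> V W) =
      (bypass B E V V U g \<odot> \<one> W) \<cdot> bypass (A \<otimes> U) (B \<otimes> U) W W V f"
    by (simp add: bypass_eq_right [of f "A \<otimes> U" W "B \<otimes> U" W V])
  finally have "(\<one> E \<odot> ?s) \<cdot> ?h \<cdot> (\<one> A \<odot> ?s') = (bypass B E V V U g \<odot> \<one> W) \<cdot> bypass (A \<otimes> U) (B \<otimes> U) W W V f"
    by (simp add: bypass_TensorO_outer)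
  with 1 2 show ?case
    by (auto simp: y intro: trace_equiv.trans)
next
  case (refl y)
  show ?case by (rule trace_equiv.refl)
next
  case (sym y z)
  then show ?case
    using trace_equiv_representative trace_equiv.sym by (metis assms(4,5))
next
  case (trans y z w)
  then show ?case
    using trace_equiv_representative trace_equiv.trans by (metis assms(4,5))
qed

text \<open>Superposing with an identity covers removal. Only the left side is treated: right
  whiskering will be defined from it by composing with symmetries, and inherits
  compatibility.\<close>

lemma trace_equiv_whisker:
  assumes "trace_equiv A B x x'" "representative A B x"
    and [simp]: "A \<in> Obj C" "B \<in> Obj C" "W \<in> Obj C"
  shows "trace_equiv (W \<otimes> A) (W \<otimes> B) (fst x, \<one> W \<odot> snd x) (fst x', \<one> W \<odot> snd x')"
  using assms(1,2)
proof induction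
  case (slide U U' f k)
  have [simp]: "U \<in> Obj C" "U' \<in> Obj C" "f \<in> Arr C" "Dom C f = A \<otimes> U" "Cod C f = B \<otimes> U'"
    "k \<in> Arr C" "Dom C k = U'" "Cod C k = U"
    using slide by (auto dest: homD)
  have "trace_equiv (W \<otimes> A) (W \<otimes> B) (U, (\<one> (W \<otimes> B) \<odot> k) \<cdot> (\<one> W \<odot> f)) (U', (\<one> W \<odot> f) \<cdot> (\<one> (W \<otimes> A) \<odot> k))"
    by (rule trace_equiv_slide) simp_all
  then show ?case
    by (simp add: whisker_left_Comp)
next
  case (hide U V f t)
  have [simp]: "U \<in> Obj C" "V \<in> Obj C" "f \<in> Arr C" "Dom C f = A \<otimes> U \<otimes> V" "Cod C f = B \<otimes> U \<otimes> V"
    using hide by (auto dest: homD)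
  show ?case
    using Tr_whisker_left [OF hide(4), of W] by (auto intro!: trace_equiv.hide homI)
next
  case (refl y)
  show ?case by (rule trace_equiv.refl)
next
  case (sym y z)
  then show ?case
    using trace_equiv_representative trace_equiv.sym by (metis assms(3,4))
next
  case (trans y z w)
  then show ?case
    using trace_equiv_representative trace_equiv.trans by (metis assms(3,4))
qed

text \<open>The traced object is put in front of the old hidden object. A removable factor thus
  stays last, and by strictness its trace in C is literally the same one, with \<open>U\<close> read
  as hidden instead of visible.\<close>

lemma trace_equiv_trace:
  assumes "trace_equiv (A \<otimes> U) (B \<otimes> U) x x'" "representative (A \<otimes> U) (B \<otimes> U) x"
    and [simp]: "A \<in> Obj C" "B \<in> Obj C" "U \<in> Obj C"
  shows "trace_equiv A B (U \<otimes> fst x, snd x) (U \<otimes> fst x', snd x')"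
  using assms(1,2)
proof induction
  case (slide V V' f k)
  have [simp]: "V \<in> Obj C" "V' \<in> Obj C" "f \<in> Arr C" "Dom C f = A \<otimes> U \<otimes> V" "Cod C f = B \<otimes> U \<otimes> V'"
    "k \<in> Arr C" "Dom C k = V'" "Cod C k = V"
    using slide by (auto dest: homD)
  have "trace_equiv A B (U \<otimes> V, (\<one> B \<odot> (\<one> U \<odot> k)) \<cdot> f) (U \<otimes> V', f \<cdot> (\<one> A \<odot> (\<one> U \<odot> k)))"
    by (rule trace_equiv_slide) simp_all
  then show ?case
    by simp
next
  case (hide V W f t)
  have [simp]: "V \<in> Obj C" "W \<in> Obj C" "f \<in> Arr C" "Dom C f = A \<otimes> U \<otimes> V \<otimes> W" "Cod C f = B \<otimes> U \<otimes> V \<otimes> W"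
    using hide by (auto dest: homD)
  have "trace_equiv A B ((U \<otimes> V) \<otimes> W, f) (U \<otimes> V, t)"
    using hide(4) by (intro trace_equiv.hide) (auto intro: homI)
  then show ?case
    by simp
next
  case (refl y)
  show ?case by (rule trace_equiv.refl)
next
  case (sym y z)
  then show ?case
    using trace_equiv_representative trace_equiv.sym by (metis assms(3-5) TensorO_Obj)
next
  case (trans y z w)
  then show ?case
    using trace_equiv_representative trace_equiv.trans by (metis assms(3-5) TensorO_Obj)
qed

section \<open>The ambient category\<close>

text \<open>Domain and codomain are stored because an arrow out of \<open>A \<otimes> U\<close> does
  not determine \<open>A\<close>.\<close>

definition cls :: "'o \<Rightarrow> 'o \<Rightarrow> 'o \<times> 'a \<Rightarrow> ('o, 'a) ambient_arrow" where
  "cls A B x = (A, B, {y. trace_equiv A B x y})"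

lemma cls_sel [simp]:
  "fst (cls A B x) = A" "fst (snd (cls A B x)) = B"
  "y \<in> snd (snd (cls A B x)) \<longleftrightarrow> trace_equiv A B x y"
  by (simp_all add: cls_def)

lemma cls_eqI: "trace_equiv A B x y \<Longrightarrow> cls A B x = cls A B y"
  unfolding cls_def by (auto intro: trace_equiv.trans trace_equiv.sym)

lemma cls_eqD: "cls A B x = cls A B y \<Longrightarrow> trace_equiv A B x y"
  unfolding cls_def using trace_equiv.refl [of A B y] by auto

text \<open>Taking the union over all representatives avoids a choice; the union is a single class
  as soon as \<open>h\<close> respects the equivalence.\<close>

definition lift_cls where
  "lift_cls A B h S = (A, B, \<Union>x \<in> S. {y. trace_equiv A B (h x) y})"

lemma lift_cls_eq:
  assumes "\<And>x'. trace_equiv A' B' x x' \<Longrightarrow> trace_equiv A B (h x) (h x')"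
  shows "lift_cls A B h {x'. trace_equiv A' B' x x'} = cls A B (h x)"
  unfolding lift_cls_def cls_def
  using assms by (auto intro: trace_equiv.trans trace_equiv.sym trace_equiv.refl)

definition pure where
  "pure f = cls (Dom C f) (Cod C f) (\<I>, f)"

definition D_comp where
  "D_comp G F = (fst F, fst (snd G), \<Union>x \<in> snd (snd F). \<Union>y \<in> snd (snd G).
     {z. trace_equiv (fst F) (fst (snd G)) (hcomp (fst F) (fst (snd F)) (fst (snd G)) y x) z})"

definition whiskl where
  "whiskl W F = lift_cls (W \<otimes> fst F) (W \<otimes> fst (snd F)) (\<lambda>x. (fst x, \<one> W \<odot> snd x)) (snd (snd F))"

definition whiskr where
  "whiskr F W = D_comp (pure (\<sigma> W (fst (snd F)))) (D_comp (whiskl W F) (pure (\<sigma> (fst F) W)))"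

text \<open>The tensor product applies \<open>F\<close> first and \<open>G\<close> second; that the
  other order gives the same arrow is \<open>whisk_exchange\<close>.\<close>

definition D :: "('o, ('o, 'a) ambient_arrow) smc" where
  "D = \<lparr>Obj = Obj C, Arr = {cls A B x | A B x. A \<in> Obj C \<and> B \<in> Obj C \<and> representative A B x},
    Dom = fst, Cod = (\<lambda>F. fst (snd F)), Ident = (\<lambda>A. pure (\<one> A)), Comp = D_comp,
    TensorO = TensorO C, TensorA = (\<lambda>F G. D_comp (whiskl (fst (snd F)) G) (whiskr F (fst G))),
    Unit = \<I>, Assoc = (\<lambda>A B E. pure (\<alpha> A B E)), LUnit = (\<lambda>A. pure (\<l> A)),
    RUnit = (\<lambda>A. pure (\<rho> A)), Symm = (\<lambda>A B. pure (\<sigma> A B))\<rparr>"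

text \<open>The value \<open>None\<close> occurs only outside the hom sets, where the axiom
  \<open>Tr_partial_function\<close> forces it.\<close>

definition D_Tr where
  "D_Tr X Y U F = (if X \<in> Obj C \<and> Y \<in> Obj C \<and> U \<in> Obj C \<and> F \<in> hom\<^bsub>D\<^esub> (X \<otimes> U) (Y \<otimes> U)
     then Some (lift_cls X Y (\<lambda>x. (U \<otimes> fst x, snd x)) (snd (snd F))) else None)"

lemma D_simps [simp]:
  "Obj D = Obj C" "TensorO D = TensorO C" "Unit D = \<I>"
  "Dom D (cls A B x) = A" "Cod D (cls A B x) = B"
  by (simp_all add: D_def)

lemma cls_Arr [simp]: "A \<in> Obj C \<Longrightarrow> B \<in> Obj C \<Longrightarrow> representative A B x \<Longrightarrow> cls A B x \<in> Arr D"
  by (simp add: D_def del: split_paired_Ex) metis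

lemma D_homE:
  assumes "F \<in> hom\<^bsub>D\<^esub> A B"
  obtains U f where "F = cls A B (U, f)" "A \<in> Obj C" "B \<in> Obj C" "U \<in> Obj C" "f \<in> Arr C"
    "Dom C f = A \<otimes> U" "Cod C f = B \<otimes> U"
  using assms unfolding Hom_def D_def by auto

lemma D_Comp:
  assumes [simp]: "A \<in> Obj C" "B \<in> Obj C" "E \<in> Obj C" and x: "representative A B x" and y: "representative B E y"
  shows "cls B E y \<cdot>\<^bsub>D\<^esub> cls A B x = cls A E (hcomp A B E y x)"
proof -
  have *: "trace_equiv A E (hcomp A B E y x) (hcomp A B E y' x')"
    if "trace_equiv A B x x'" "trace_equiv B E y y'" for x' y'
    using trace_equiv_hcomp_left [OF that(2) y] trace_equiv_hcomp_right [OF that(1) x]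
      trace_equiv_representative [OF that(1)] trace_equiv_representative [OF that(2)] x y
    by (metis assms(1-3) trace_equiv.trans)
  show ?thesis
    unfolding D_def cls_def D_comp_def
    by (auto intro: * trace_equiv.trans trace_equiv.sym trace_equiv.refl)
qed

lemma whiskl_cls:
  assumes [simp]: "A \<in> Obj C" "B \<in> Obj C" "W \<in> Obj C" and "representative A B (U, f)"
  shows "whiskl W (cls A B (U, f)) = cls (W \<otimes> A) (W \<otimes> B) (U, \<one> W \<odot> f)"
  unfolding whiskl_def
  using lift_cls_eq [of A B "(U, f)" "W \<otimes> A" "W \<otimes> B" "\<lambda>x. (fst x, \<one> W \<odot> snd x)"]
    trace_equiv_whisker [OF _ assms(4), of _ W]
  by (simp add: cls_def)

lemma D_Tr_cls:
  assumes [simp]: "A \<in> Obj C" "B \<in> Obj C" "U \<in> Obj C" and "representative (A \<otimes> U) (B \<otimes> U) (V, f)"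
  shows "D_Tr A B U (cls (A \<otimes> U) (B \<otimes> U) (V, f)) = Some (cls A B (U \<otimes> V, f))"
proof -
  have "cls (A \<otimes> U) (B \<otimes> U) (V, f) \<in> hom\<^bsub>D\<^esub> (A \<otimes> U) (B \<otimes> U)"
    using assms by (simp add: Hom_def)
  then show ?thesis
    unfolding D_Tr_def
    using lift_cls_eq [of "A \<otimes> U" "B \<otimes> U" "(V, f)" A B "\<lambda>x. (U \<otimes> fst x, snd x)"]
      trace_equiv_trace [OF _ assms(4)]
    by (simp add: cls_def)
qed

lemma pure_Comp_cls:
  assumes [simp]: "A \<in> Obj C" "B \<in> Obj C" "U \<in> Obj C" "f \<in> Arr C" "Dom C f = A \<otimes> U"
    "Cod C f = B \<otimes> U" "h \<in> Arr C" "Dom C h = B" "Cod C h = E"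
  shows "pure h \<cdot>\<^bsub>D\<^esub> cls A B (U, f) = cls A E (U, (h \<odot> \<one> U) \<cdot> f)"
proof -
  have [simp]: "E \<in> Obj C"
    using Cod_Obj [of h] by simp
  show ?thesis
    by (simp add: pure_def D_Comp bypass_pure_left)
qed

lemma cls_Comp_pure:
  assumes [simp]: "A \<in> Obj C" "B \<in> Obj C" "U \<in> Obj C" "f \<in> Arr C" "Dom C f = A \<otimes> U"
    "Cod C f = B \<otimes> U" "h \<in> Arr C" "Dom C h = E" "Cod C h = A"
  shows "cls A B (U, f) \<cdot>\<^bsub>D\<^esub> pure h = cls E B (U, f \<cdot> (h \<odot> \<one> U))"
proof -
  have [simp]: "E \<in> Obj C"
    using Dom_Obj [of h] by simp
  show ?thesis
    by (simp add: pure_def D_Comp bypass_Unit)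
qed

lemma D_Ident: "\<one>\<^bsub>D\<^esub> A = pure (\<one> A)"
  by (simp add: D_def)

lemma D_Symm: "\<sigma>\<^bsub>D\<^esub> A B = pure (\<sigma> A B)"
  by (simp add: D_def)

lemma D_TensorA: "F \<odot>\<^bsub>D\<^esub> G = whiskl (Cod D F) G \<cdot>\<^bsub>D\<^esub> whiskr F (Dom D G)"
  by (simp add: D_def)

lemma D_coherence [simp]:
  "A \<in> Obj C \<Longrightarrow> B \<in> Obj C \<Longrightarrow> E \<in> Obj C \<Longrightarrow> \<alpha>\<^bsub>D\<^esub> A B E = \<one>\<^bsub>D\<^esub> (A \<otimes> B \<otimes> E)"
  "A \<in> Obj C \<Longrightarrow> \<l>\<^bsub>D\<^esub> A = \<one>\<^bsub>D\<^esub> A" "A \<in> Obj C \<Longrightarrow> \<rho>\<^bsub>D\<^esub> A = \<one>\<^bsub>D\<^esub> A"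
  by (simp_all add: D_def)

lemma pure_Arr [simp]:
  assumes "f \<in> Arr C"
  shows "pure f \<in> Arr D" "Dom D (pure f) = Dom C f" "Cod D (pure f) = Cod C f"
  using assms by (simp_all add: pure_def)

text \<open>This is the origin of \<open>bypass\<close>: conjugating
  \<open>\<one> W \<odot> f\<close> by the symmetries of the visible objects gives its defining
  formula.\<close>

lemma whiskr_cls:
  assumes [simp]: "A \<in> Obj C" "B \<in> Obj C" "W \<in> Obj C" "U \<in> Obj C" "f \<in> Arr C"
    "Dom C f = A \<otimes> U" "Cod C f = B \<otimes> U"
  shows "whiskr (cls A B (U, f)) W = cls (A \<otimes> W) (B \<otimes> W) (U, bypass A B U U W f)"
proof -
  have "whiskr (cls A B (U, f)) W =
      pure (\<sigma> W B) \<cdot>\<^bsub>D\<^esub> (whiskl W (cls A B (U, f)) \<cdot>\<^bsub>D\<^esub> pure (\<sigma> A W))"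
    by (simp add: whiskr_def D_def)
  also have "\<dots> = cls (A \<otimes> W) (B \<otimes> W) (U, bypass A B U U W f)"
    by (simp add: whiskl_cls cls_Comp_pure pure_Comp_cls bypass_def)
  finally show ?thesis .
qed

lemma category_D: "category D"
proof
  fix F assume "F \<in> Arr D"
  then have "F \<in> hom\<^bsub>D\<^esub> (Dom D F) (Cod D F)"
    by (simp add: Hom_def)
  then show "Dom D F \<in> Obj D" "Cod D F \<in> Obj D"
    by (auto elim: D_homE)
next
  fix A assume "A \<in> Obj D"
  then show "\<one>\<^bsub>D\<^esub> A \<in> hom\<^bsub>D\<^esub> A A"
    by (simp add: D_Ident Hom_def)
next
  fix A B E F G assume "F \<in> hom\<^bsub>D\<^esub> A B" "G \<in> hom\<^bsub>D\<^esub> B E"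
  then show "G \<cdot>\<^bsub>D\<^esub> F \<in> hom\<^bsub>D\<^esub> A E"
    by (auto elim!: D_homE simp: D_Comp) (simp add: Hom_def)
next
  fix A B F assume "F \<in> hom\<^bsub>D\<^esub> A B"
  then show "\<one>\<^bsub>D\<^esub> B \<cdot>\<^bsub>D\<^esub> F = F" "F \<cdot>\<^bsub>D\<^esub> \<one>\<^bsub>D\<^esub> A = F"
    by (auto elim!: D_homE simp: D_Ident pure_Comp_cls cls_Comp_pure)
next
  fix A1 A2 A3 A4 F G H
  assume "F \<in> hom\<^bsub>D\<^esub> A1 A2" "G \<in> hom\<^bsub>D\<^esub> A2 A3" "H \<in> hom\<^bsub>D\<^esub> A3 A4"
  then obtain U f V g W h where
    [simp]: "F = cls A1 A2 (U, f)" "G = cls A2 A3 (V, g)" "H = cls A3 A4 (W, h)"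
      "A1 \<in> Obj C" "A2 \<in> Obj C" "A3 \<in> Obj C" "A4 \<in> Obj C" "U \<in> Obj C" "V \<in> Obj C" "W \<in> Obj C"
      "f \<in> Arr C" "Dom C f = A1 \<otimes> U" "Cod C f = A2 \<otimes> U"
      "g \<in> Arr C" "Dom C g = A2 \<otimes> V" "Cod C g = A3 \<otimes> V"
      "h \<in> Arr C" "Dom C h = A3 \<otimes> W" "Cod C h = A4 \<otimes> W"
    by (elim D_homE)
  \<comment> \<open>Both bracketings of the triple composite have the hidden object
    \<open>U \<otimes> V \<otimes> W\<close>, and their representatives are equal arrows of
    C.\<close>
  have "bypass A2 A4 (V \<otimes> W) (V \<otimes> W) U (bypass A3 A4 W W V h \<cdot> (g \<odot> \<one> W)) =
      bypass A3 A4 W W (U \<otimes> V) h \<cdot> (bypass A2 A3 V V U g \<odot> \<one> W)"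
    by (subst bypass_Comp [where U' = "V \<otimes> W" and B = A3])
      (simp_all add: bypass_TensorO_inner bypass_whisker_right)
  then show "(H \<cdot>\<^bsub>D\<^esub> G) \<cdot>\<^bsub>D\<^esub> F = H \<cdot>\<^bsub>D\<^esub> (G \<cdot>\<^bsub>D\<^esub> F)"
    by (simp add: D_Comp whisker_right_Comp)
qed

end

sublocale strict_partially_traced \<subseteq> D: category D
  by (rule category_D)

section \<open>Whiskering in the ambient category and its symmetric monoidal structure\<close>

context strict_partially_traced
begin

lemma whiskl_Arr [simp]:
  assumes "F \<in> Arr D" "W \<in> Obj C"
  shows "whiskl W F \<in> Arr D" "Dom D (whiskl W F) = W \<otimes> Dom D F" "Cod D (whiskl W F) = W \<otimes> Cod D F"
proof -
  obtain A B where "F \<in> hom\<^bsub>D\<^esub> A B"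
    using assms(1) by (simp add: Hom_def)
  with assms show "whiskl W F \<in> Arr D" "Dom D (whiskl W F) = W \<otimes> Dom D F" "Cod D (whiskl W F) = W \<otimes> Cod D F"
    by (auto elim!: D_homE simp: whiskl_cls)
qed

lemma whiskr_Arr [simp]:
  assumes "F \<in> Arr D" "W \<in> Obj C"
  shows "whiskr F W \<in> Arr D" "Dom D (whiskr F W) = Dom D F \<otimes> W" "Cod D (whiskr F W) = Cod D F \<otimes> W"
proof -
  obtain A B where "F \<in> hom\<^bsub>D\<^esub> A B"
    using assms(1) by (simp add: Hom_def)
  with assms show "whiskr F W \<in> Arr D" "Dom D (whiskr F W) = Dom D F \<otimes> W" "Cod D (whiskr F W) = Cod D F \<otimes> W"
    by (auto elim!: D_homE simp: whiskr_cls)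
qed

lemma pure_Comp:
  assumes "f \<in> Arr C" "g \<in> Arr C" "Cod C f = Dom C g"
  shows "pure (g \<cdot> f) = pure g \<cdot>\<^bsub>D\<^esub> pure f"
  using assms pure_Comp_cls [of "Dom C f" "Dom C g" \<I> f g "Cod C g"] by (simp add: pure_def)

lemma whiskl_pure [simp]: "f \<in> Arr C \<Longrightarrow> W \<in> Obj C \<Longrightarrow> whiskl W (pure f) = pure (\<one> W \<odot> f)"
  by (simp add: pure_def whiskl_cls)

lemma whiskr_pure [simp]: "f \<in> Arr C \<Longrightarrow> W \<in> Obj C \<Longrightarrow> whiskr (pure f) W = pure (f \<odot> \<one> W)"
  by (simp add: pure_def whiskr_cls bypass_pure_left)

lemma whiskl_Comp:
  assumes "F \<in> Arr D" "G \<in> Arr D" "Cod D F = Dom D G" "W \<in> Obj C"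
  shows "whiskl W (G \<cdot>\<^bsub>D\<^esub> F) = whiskl W G \<cdot>\<^bsub>D\<^esub> whiskl W F"
proof -
  obtain A B E where *: "F \<in> hom\<^bsub>D\<^esub> A B" "G \<in> hom\<^bsub>D\<^esub> B E"
    using assms by (auto simp: Hom_def)
  show ?thesis
    using * assms(4) by (auto elim!: D_homE simp: whiskl_cls D_Comp whisker_left_Comp bypass_whisker_left)
qed

lemma whiskr_Comp:
  assumes "F \<in> Arr D" "G \<in> Arr D" "Cod D F = Dom D G" "W \<in> Obj C"
  shows "whiskr (G \<cdot>\<^bsub>D\<^esub> F) W = whiskr G W \<cdot>\<^bsub>D\<^esub> whiskr F W"
proof -
  obtain A B E where *: "F \<in> hom\<^bsub>D\<^esub> A B" "G \<in> hom\<^bsub>D\<^esub> B E"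
    using assms by (auto simp: Hom_def)
  obtain U f V g where
    [simp]: "F = cls A B (U, f)" "G = cls B E (V, g)"
      "A \<in> Obj C" "B \<in> Obj C" "E \<in> Obj C" "U \<in> Obj C" "V \<in> Obj C"
      "f \<in> Arr C" "Dom C f = A \<otimes> U" "Cod C f = B \<otimes> U"
      "g \<in> Arr C" "Dom C g = B \<otimes> V" "Cod C g = E \<otimes> V"
    using * by (elim D_homE)
  \<comment> \<open>In one nesting \<open>W\<close> joins \<open>U\<close> on the left, in the other
    \<open>U\<close> joins \<open>W\<close> on the right; both are a single bypass of
    \<open>g\<close> along \<open>W \<otimes> U\<close>.\<close>
  have "bypass A E (U \<otimes> V) (U \<otimes> V) W (bypass B E V V U g \<cdot> (f \<odot> \<one> V)) =
    bypass (B \<otimes> W) (E \<otimes> W) V V U (bypass B E V V W g) \<cdot> (bypass A B U U W f \<odot> \<one> V)"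
    using assms(4) by (subst bypass_Comp [where U' = "U \<otimes> V" and B = B])
      (simp_all add: bypass_TensorO_inner bypass_TensorO_outer bypass_whisker_right)
  then show ?thesis
    using assms(4) by (simp add: whiskr_cls D_Comp)
qed

lemma whiskl_whiskl [simp]:
  assumes "F \<in> Arr D" "W \<in> Obj C" "W' \<in> Obj C"
  shows "whiskl W (whiskl W' F) = whiskl (W \<otimes> W') F"
proof -
  obtain A B where "F \<in> hom\<^bsub>D\<^esub> A B"
    using assms(1) by (simp add: Hom_def)
  with assms show ?thesis
    by (auto elim!: D_homE simp: whiskl_cls)
qed

lemma whiskr_whiskr [simp]:
  assumes "F \<in> Arr D" "W \<in> Obj C" "W' \<in> Obj C"
  shows "whiskr (whiskr F W) W' = whiskr F (W \<otimes> W')"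
proof -
  obtain A B where "F \<in> hom\<^bsub>D\<^esub> A B"
    using assms(1) by (simp add: Hom_def)
  with assms show ?thesis
    by (auto elim!: D_homE simp: whiskr_cls bypass_TensorO_outer)
qed

lemma whiskr_whiskl [simp]:
  assumes "F \<in> Arr D" "W \<in> Obj C" "W' \<in> Obj C"
  shows "whiskr (whiskl W F) W' = whiskl W (whiskr F W')"
proof -
  obtain A B where "F \<in> hom\<^bsub>D\<^esub> A B"
    using assms(1) by (simp add: Hom_def)
  with assms show ?thesis
    by (auto elim!: D_homE simp: whiskr_cls whiskl_cls bypass_whisker_left)
qed

lemma whisk_Unit [simp]:
  assumes "F \<in> Arr D"
  shows "whiskl \<I> F = F" "whiskr F \<I> = F"
proof -
  obtain A B where "F \<in> hom\<^bsub>D\<^esub> A B"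
    using assms(1) by (simp add: Hom_def)
  with assms show "whiskl \<I> F = F" "whiskr F \<I> = F"
    by (auto elim!: D_homE simp: whiskl_cls whiskr_cls bypass_Unit)
qed

text \<open>The two composites meet \<open>F\<close> and \<open>G\<close> in opposite orders, so
  their hidden objects are \<open>V \<otimes> U\<close> and \<open>U \<otimes> V\<close>. The
  equality is one of classes, obtained by conjugating with the symmetry.\<close>

lemma whisk_exchange:
  assumes "F \<in> Arr D" "G \<in> Arr D" "Dom D F = A" "Cod D F = B" "Dom D G = A'" "Cod D G = B'"
  shows "whiskr F B' \<cdot>\<^bsub>D\<^esub> whiskl A G = whiskl B G \<cdot>\<^bsub>D\<^esub> whiskr F A'"
proof -
  have "F \<in> hom\<^bsub>D\<^esub> A B" "G \<in> hom\<^bsub>D\<^esub> A' B'"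
    using assms by (auto simp: Hom_def)
  then obtain U f V g where
    [simp]: "F = cls A B (U, f)" "G = cls A' B' (V, g)"
      "A \<in> Obj C" "B \<in> Obj C" "A' \<in> Obj C" "B' \<in> Obj C" "U \<in> Obj C" "V \<in> Obj C"
      "f \<in> Arr C" "Dom C f = A \<otimes> U" "Cod C f = B \<otimes> U"
      "g \<in> Arr C" "Dom C g = A' \<otimes> V" "Cod C g = B' \<otimes> V"
    by (elim D_homE)
  let ?p = "bypass A B U U A' f"
  let ?h = "(\<one> B \<odot> (g \<odot> \<one> U)) \<cdot> bypass A B U U (A' \<otimes> V) f"
  \<comment> \<open>In right-hand form the bypasses consist of \<open>?p\<close> beside
    \<open>V\<close>, \<open>g\<close> beside \<open>U\<close>, and crossings of \<open>U\<close>
    with \<open>V\<close>. Conjugation cancels the first crossing of \<open>?h\<close> by 3 and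
    completes the part around \<open>g\<close> to the bypass in 2.\<close>
  have 1: "?h = (\<one> B \<odot> (g \<odot> \<one> U)) \<cdot> (\<one> (B \<otimes> A') \<odot> \<sigma> U V) \<cdot> (?p \<odot> \<one> V) \<cdot> (\<one> (A \<otimes> A') \<odot> \<sigma> V U)"
    by (simp add: bypass_eq_right [of ?p "A \<otimes> A'" U "B \<otimes> A'" U V] flip: bypass_TensorO_outer)
  have 2: "bypass (B \<otimes> A') (B \<otimes> B') V V U (\<one> B \<odot> g) =
     (\<one> (B \<otimes> B') \<odot> \<sigma> V U) \<cdot> (\<one> B \<odot> (g \<odot> \<one> U)) \<cdot> (\<one> (B \<otimes> A') \<odot> \<sigma> U V)"
    by (simp add: bypass_eq_right)
  have 3: "(\<one> (A \<otimes> A') \<odot> \<sigma> V U) \<cdot> (\<one> (A \<otimes> A') \<odot> \<sigma> U V) = \<one> (A \<otimes> A' \<otimes> U \<otimes> V)"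
    using Symm_Symm_whisker(2) [of U V "A \<otimes> A'"] by simp
  have "whiskr F B' \<cdot>\<^bsub>D\<^esub> whiskl A G = cls (A \<otimes> A') (B \<otimes> B') (V \<otimes> U, ?h)"
    by (simp add: whiskr_cls whiskl_cls D_Comp bypass_TensorO_outer bypass_natural)
  also have "\<dots> = cls (A \<otimes> A') (B \<otimes> B')
      (U \<otimes> V, (\<one> (B \<otimes> B') \<odot> \<sigma> V U) \<cdot> ?h \<cdot> (\<one> (A \<otimes> A') \<odot> \<sigma> U V))"
    by (intro cls_eqI trace_equiv_conjugate) (simp_all add: Symm_Symm)
  also have "(\<one> (B \<otimes> B') \<odot> \<sigma> V U) \<cdot> ?h \<cdot> (\<one> (A \<otimes> A') \<odot> \<sigma> U V) =
     bypass (B \<otimes> A') (B \<otimes> B') V V U (\<one> B \<odot> g) \<cdot> (?p \<odot> \<one> V)"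
    unfolding 1 2 by (simp add: 3)
  also have "cls (A \<otimes> A') (B \<otimes> B') (U \<otimes> V, \<dots>) = whiskl B G \<cdot>\<^bsub>D\<^esub> whiskr F A'"
    by (simp add: whiskr_cls whiskl_cls D_Comp)
  finally show ?thesis .
qed

lemma whiskr_Comp_Symm:
  assumes "F \<in> Arr D" "Dom D F = A" "Cod D F = B" "W \<in> Obj C"
  shows "whiskr F W \<cdot>\<^bsub>D\<^esub> pure (\<sigma> W A) = pure (\<sigma> W B) \<cdot>\<^bsub>D\<^esub> whiskl W F"
proof -
  have "F \<in> hom\<^bsub>D\<^esub> A B"
    using assms by (simp add: Hom_def)
  then show ?thesis
    using assms(4)
    by (auto elim!: D_homE simp: whiskr_cls whiskl_cls cls_Comp_pure pure_Comp_cls bypass_def Symm_Symm_whisker)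
qed

lemma pure_TensorA:
  assumes "f \<in> Arr C" "g \<in> Arr C"
  shows "pure f \<odot>\<^bsub>D\<^esub> pure g = pure (f \<odot> g)"
  using assms by (simp add: D_TensorA TensorA_Comp' flip: pure_Comp)

lemma TensorA_Ident_D:
  assumes "F \<in> Arr D" "W \<in> Obj C"
  shows "F \<odot>\<^bsub>D\<^esub> \<one>\<^bsub>D\<^esub> W = whiskr F W" "\<one>\<^bsub>D\<^esub> W \<odot>\<^bsub>D\<^esub> F = whiskl W F"
proof -
  have [simp]: "Dom D F \<in> Obj C" "Cod D F \<in> Obj C"
    using D.Dom_Obj D.Cod_Obj assms by simp_all
  have "whiskl (Cod D F) (\<one>\<^bsub>D\<^esub> W) = \<one>\<^bsub>D\<^esub> (Cod D F \<otimes> W)"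
    "whiskr (\<one>\<^bsub>D\<^esub> W) (Dom D F) = \<one>\<^bsub>D\<^esub> (W \<otimes> Dom D F)"
    using assms by (simp_all add: D_Ident)
  then show "F \<odot>\<^bsub>D\<^esub> \<one>\<^bsub>D\<^esub> W = whiskr F W" "\<one>\<^bsub>D\<^esub> W \<odot>\<^bsub>D\<^esub> F = whiskl W F"
    using assms by (simp_all add: D_TensorA)
qed

lemma symmetric_monoidal_category_D: "symmetric_monoidal_category D"
proof
  show "\<I>\<^bsub>D\<^esub> \<in> Obj D"
    by simp
next
  \<comment> \<open>Identities, unitors and symmetries are all pure, so equations among them come
    from C through \<open>pure_Comp\<close> and \<open>pure_TensorA\<close>.\<close>
  fix A B assume "A \<in> Obj D" "B \<in> Obj D"
  then show "A \<otimes>\<^bsub>D\<^esub> B \<in> Obj D" "\<one>\<^bsub>D\<^esub> A \<odot>\<^bsub>D\<^esub> \<one>\<^bsub>D\<^esub> B = \<one>\<^bsub>D\<^esub> (A \<otimes>\<^bsub>D\<^esub> B)"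
    "(\<one>\<^bsub>D\<^esub> A \<odot>\<^bsub>D\<^esub> \<l>\<^bsub>D\<^esub> B) \<cdot>\<^bsub>D\<^esub> \<alpha>\<^bsub>D\<^esub> A \<I>\<^bsub>D\<^esub> B = \<rho>\<^bsub>D\<^esub> A \<odot>\<^bsub>D\<^esub> \<one>\<^bsub>D\<^esub> B"
    "\<sigma>\<^bsub>D\<^esub> A B \<in> hom\<^bsub>D\<^esub> (A \<otimes>\<^bsub>D\<^esub> B) (B \<otimes>\<^bsub>D\<^esub> A)"
    "\<sigma>\<^bsub>D\<^esub> B A \<cdot>\<^bsub>D\<^esub> \<sigma>\<^bsub>D\<^esub> A B = \<one>\<^bsub>D\<^esub> (A \<otimes>\<^bsub>D\<^esub> B)"
    by (simp_all add: D_Ident D_Symm pure_TensorA Hom_def Symm_Symm flip: pure_Comp)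
next
  fix F A A' G B B' assume "F \<in> hom\<^bsub>D\<^esub> A A'" "G \<in> hom\<^bsub>D\<^esub> B B'"
  then have [simp]: "F \<in> Arr D" "Dom D F = A" "Cod D F = A'" "G \<in> Arr D" "Dom D G = B" "Cod D G = B'"
    and [simp]: "A \<in> Obj C" "A' \<in> Obj C" "B \<in> Obj C" "B' \<in> Obj C"
    using D.homD by auto
  show "F \<odot>\<^bsub>D\<^esub> G \<in> hom\<^bsub>D\<^esub> (A \<otimes>\<^bsub>D\<^esub> B) (A' \<otimes>\<^bsub>D\<^esub> B')"
    by (simp add: D_TensorA Hom_def)
  have "\<sigma>\<^bsub>D\<^esub> A' B' \<cdot>\<^bsub>D\<^esub> (F \<odot>\<^bsub>D\<^esub> G) = (pure (\<sigma> A' B') \<cdot>\<^bsub>D\<^esub> whiskl A' G) \<cdot>\<^bsub>D\<^esub> whiskr F B"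
    by (simp add: D_TensorA D_Symm)
  also have "\<dots> = whiskr G A' \<cdot>\<^bsub>D\<^esub> pure (\<sigma> A' B) \<cdot>\<^bsub>D\<^esub> whiskr F B"
    by (simp flip: whiskr_Comp_Symm [of G B B' A'])
  also have "pure (\<sigma> A' B) \<cdot>\<^bsub>D\<^esub> whiskr F B = whiskl B F \<cdot>\<^bsub>D\<^esub> pure (\<sigma> A B)"
proof -
    \<comment> \<open>The mirror image of \<open>whiskr_Comp_Symm\<close> follows by inserting a
      symmetry and its inverse in front of \<open>whiskr F B\<close>.\<close>
    have "pure (\<sigma> A' B) \<cdot>\<^bsub>D\<^esub> whiskr F B =
        pure (\<sigma> A' B) \<cdot>\<^bsub>D\<^esub> (whiskr F B \<cdot>\<^bsub>D\<^esub> pure (\<sigma> B A)) \<cdot>\<^bsub>D\<^esub> pure (\<sigma> A B)"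
      by (simp add: Symm_Symm D_Ident [symmetric] flip: pure_Comp)
    also have "\<dots> = (pure (\<sigma> A' B) \<cdot>\<^bsub>D\<^esub> pure (\<sigma> B A')) \<cdot>\<^bsub>D\<^esub> whiskl B F \<cdot>\<^bsub>D\<^esub> pure (\<sigma> A B)"
      by (simp add: whiskr_Comp_Symm [of F A A' B])
    also have "\<dots> = whiskl B F \<cdot>\<^bsub>D\<^esub> pure (\<sigma> A B)"
      by (simp add: Symm_Symm D_Ident [symmetric] del: D.Comp_assoc' flip: pure_Comp)
    finally show ?thesis .
  qed
  also have "whiskr G A' \<cdot>\<^bsub>D\<^esub> whiskl B F \<cdot>\<^bsub>D\<^esub> pure (\<sigma> A B) = (whiskr G A' \<cdot>\<^bsub>D\<^esub> whiskl B F) \<cdot>\<^bsub>D\<^esub> pure (\<sigma> A B)"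
    by simp
  \<comment> \<open>Passing the symmetry across leaves \<open>F\<close> acting before
    \<open>G\<close>, whereas \<open>G \<odot> F\<close> applies \<open>G\<close> first; the
    exchange law reverses the order.\<close>
  also have "\<dots> = (G \<odot>\<^bsub>D\<^esub> F) \<cdot>\<^bsub>D\<^esub> \<sigma>\<^bsub>D\<^esub> A B"
    by (subst whisk_exchange [of G F B B' A A']) (simp_all add: D_TensorA D_Symm)
  finally show "\<sigma>\<^bsub>D\<^esub> A' B' \<cdot>\<^bsub>D\<^esub> (F \<odot>\<^bsub>D\<^esub> G) = (G \<odot>\<^bsub>D\<^esub> F) \<cdot>\<^bsub>D\<^esub> \<sigma>\<^bsub>D\<^esub> A B" .
next
  fix F A A' F' A'' G B B' G' B''
  assume "F \<in> hom\<^bsub>D\<^esub> A A'" "F' \<in> hom\<^bsub>D\<^esub> A' A''" "G \<in> hom\<^bsub>D\<^esub> B B'" "G' \<in> hom\<^bsub>D\<^esub> B' B''"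
  then have [simp]: "F \<in> Arr D" "Dom D F = A" "Cod D F = A'" "G \<in> Arr D" "Dom D G = B" "Cod D G = B'"
      "F' \<in> Arr D" "Dom D F' = A'" "Cod D F' = A''" "G' \<in> Arr D" "Dom D G' = B'" "Cod D G' = B''"
    and [simp]: "A \<in> Obj C" "A' \<in> Obj C" "B \<in> Obj C" "B' \<in> Obj C" "A'' \<in> Obj C" "B'' \<in> Obj C"
    using D.homD by auto
  have "(F' \<cdot>\<^bsub>D\<^esub> F) \<odot>\<^bsub>D\<^esub> (G' \<cdot>\<^bsub>D\<^esub> G) =
      whiskl A'' G' \<cdot>\<^bsub>D\<^esub> (whiskl A'' G \<cdot>\<^bsub>D\<^esub> whiskr F' B) \<cdot>\<^bsub>D\<^esub> whiskr F B"
    by (simp add: D_TensorA whiskl_Comp whiskr_Comp)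
  \<comment> \<open>Each whiskering is functorial by itself, so bifunctoriality comes down to
    interchanging the two middle factors.\<close>
  also have "whiskl A'' G \<cdot>\<^bsub>D\<^esub> whiskr F' B = whiskr F' B' \<cdot>\<^bsub>D\<^esub> whiskl A' G"
    by (rule whisk_exchange [symmetric]) simp_all
  finally show "(F' \<cdot>\<^bsub>D\<^esub> F) \<odot>\<^bsub>D\<^esub> (G' \<cdot>\<^bsub>D\<^esub> G) = (F' \<odot>\<^bsub>D\<^esub> G') \<cdot>\<^bsub>D\<^esub> (F \<odot>\<^bsub>D\<^esub> G)"
    by (simp add: D_TensorA)
next
  fix A B E assume [simp]: "A \<in> Obj D" "B \<in> Obj D" "E \<in> Obj D"
  have [simp]: "A \<in> Obj C" "B \<in> Obj C" "E \<in> Obj C"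
    using D_simps(1) \<open>A \<in> Obj D\<close> \<open>B \<in> Obj D\<close> \<open>E \<in> Obj D\<close> by blast+
  show "\<alpha>\<^bsub>D\<^esub> A B E \<in> hom\<^bsub>D\<^esub> ((A \<otimes>\<^bsub>D\<^esub> B) \<otimes>\<^bsub>D\<^esub> E) (A \<otimes>\<^bsub>D\<^esub> (B \<otimes>\<^bsub>D\<^esub> E))"
    "is_iso D (\<alpha>\<^bsub>D\<^esub> A B E)"
    by (simp_all add: D.Ident_hom D.is_iso_Ident)
  show "\<alpha>\<^bsub>D\<^esub> B E A \<cdot>\<^bsub>D\<^esub> \<sigma>\<^bsub>D\<^esub> A (B \<otimes>\<^bsub>D\<^esub> E) \<cdot>\<^bsub>D\<^esub> \<alpha>\<^bsub>D\<^esub> A B E =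
    (\<one>\<^bsub>D\<^esub> B \<odot>\<^bsub>D\<^esub> \<sigma>\<^bsub>D\<^esub> A E) \<cdot>\<^bsub>D\<^esub> \<alpha>\<^bsub>D\<^esub> B A E \<cdot>\<^bsub>D\<^esub> (\<sigma>\<^bsub>D\<^esub> A B \<odot>\<^bsub>D\<^esub> \<one>\<^bsub>D\<^esub> E)"
    by (simp add: D_Ident D_Symm pure_TensorA Symm_TensorO_right flip: pure_Comp)
next
  fix F A A' G B B' H E E' assume "F \<in> hom\<^bsub>D\<^esub> A A'" "G \<in> hom\<^bsub>D\<^esub> B B'" "H \<in> hom\<^bsub>D\<^esub> E E'"
  then have [simp]: "F \<in> Arr D" "Dom D F = A" "Cod D F = A'" "G \<in> Arr D" "Dom D G = B" "Cod D G = B'"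
      "H \<in> Arr D" "Dom D H = E" "Cod D H = E'"
    and [simp]: "A \<in> Obj C" "A' \<in> Obj C" "B \<in> Obj C" "B' \<in> Obj C" "E \<in> Obj C" "E' \<in> Obj C"
    using D.homD by auto
  show "\<alpha>\<^bsub>D\<^esub> A' B' E' \<cdot>\<^bsub>D\<^esub> ((F \<odot>\<^bsub>D\<^esub> G) \<odot>\<^bsub>D\<^esub> H) = (F \<odot>\<^bsub>D\<^esub> (G \<odot>\<^bsub>D\<^esub> H)) \<cdot>\<^bsub>D\<^esub> \<alpha>\<^bsub>D\<^esub> A B E"
    by (simp add: D_TensorA whiskl_Comp whiskr_Comp)
next
  fix A assume "A \<in> Obj D"
  then show "\<l>\<^bsub>D\<^esub> A \<in> hom\<^bsub>D\<^esub> (\<I>\<^bsub>D\<^esub> \<otimes>\<^bsub>D\<^esub> A) A" "is_iso D (\<l>\<^bsub>D\<^esub> A)"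
    "\<rho>\<^bsub>D\<^esub> A \<in> hom\<^bsub>D\<^esub> (A \<otimes>\<^bsub>D\<^esub> \<I>\<^bsub>D\<^esub>) A" "is_iso D (\<rho>\<^bsub>D\<^esub> A)"
    by (simp_all add: D.Ident_hom D.is_iso_Ident)
next
  fix F A A' assume "F \<in> hom\<^bsub>D\<^esub> A A'"
  then have "F \<in> Arr D" "Dom D F = A" "Cod D F = A'" "A \<in> Obj C" "A' \<in> Obj C"
    using D.homD by auto
  then show "\<l>\<^bsub>D\<^esub> A' \<cdot>\<^bsub>D\<^esub> (\<one>\<^bsub>D\<^esub> \<I>\<^bsub>D\<^esub> \<odot>\<^bsub>D\<^esub> F) = F \<cdot>\<^bsub>D\<^esub> \<l>\<^bsub>D\<^esub> A"
    "\<rho>\<^bsub>D\<^esub> A' \<cdot>\<^bsub>D\<^esub> (F \<odot>\<^bsub>D\<^esub> \<one>\<^bsub>D\<^esub> \<I>\<^bsub>D\<^esub>) = F \<cdot>\<^bsub>D\<^esub> \<rho>\<^bsub>D\<^esub> A"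
    by (simp_all add: TensorA_Ident_D)
next
  fix A B E G assume "A \<in> Obj D" "B \<in> Obj D" "E \<in> Obj D" "G \<in> Obj D"
  then show "(\<one>\<^bsub>D\<^esub> A \<odot>\<^bsub>D\<^esub> \<alpha>\<^bsub>D\<^esub> B E G) \<cdot>\<^bsub>D\<^esub> \<alpha>\<^bsub>D\<^esub> A (B \<otimes>\<^bsub>D\<^esub> E) G \<cdot>\<^bsub>D\<^esub> (\<alpha>\<^bsub>D\<^esub> A B E \<odot>\<^bsub>D\<^esub> \<one>\<^bsub>D\<^esub> G) =
       \<alpha>\<^bsub>D\<^esub> A B (E \<otimes>\<^bsub>D\<^esub> G) \<cdot>\<^bsub>D\<^esub> \<alpha>\<^bsub>D\<^esub> (A \<otimes>\<^bsub>D\<^esub> B) E G"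
    by (simp add: D_Ident pure_TensorA flip: pure_Comp)
qed

end

sublocale strict_partially_traced \<subseteq> D: symmetric_monoidal_category D
  by (rule symmetric_monoidal_category_D)

context strict_partially_traced
begin

section \<open>The total trace\<close>

lemma D_Tr_SomeE:
  assumes "F \<in> hom\<^bsub>D\<^esub> (X \<otimes> U) (Y \<otimes> U)" "X \<in> Obj C" "Y \<in> Obj C" "U \<in> Obj C"
  obtains T where "D_Tr X Y U F = Some T" "T \<in> Arr D" "Dom D T = X" "Cod D T = Y"
proof -
  from assms(1) obtain V f where F: "F = cls (X \<otimes> U) (Y \<otimes> U) (V, f)"
    and Vf: "V \<in> Obj C" "f \<in> Arr C" "Dom C f = (X \<otimes> U) \<otimes> V" "Cod C f = (Y \<otimes> U) \<otimes> V"
    by (rule D_homE)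
  show thesis
    using assms(2-4) Vf by (intro that [of "cls X Y (U \<otimes> V, f)"]) (simp_all add: F D_Tr_cls)
qed

text \<open>If \<open>F\<close> hides \<open>V\<close> and \<open>H\<close> hides \<open>W\<close>,
  then tracing before or after composing gives \<open>U \<otimes> V \<otimes> W\<close> both times,
  with the same arrow.\<close>

lemma D_Tr_Comp_left:
  assumes "F \<in> hom\<^bsub>D\<^esub> (X \<otimes> U) (Y \<otimes> U)" "H \<in> hom\<^bsub>D\<^esub> Y Y'" "X \<in> Obj C" "U \<in> Obj C"
  shows "D_Tr X Y' U (whiskr H U \<cdot>\<^bsub>D\<^esub> F) = map_option (\<lambda>T. H \<cdot>\<^bsub>D\<^esub> T) (D_Tr X Y U F)"
  using assms
  by (auto elim!: D_homE simp: whiskr_cls D_Comp D_Tr_cls bypass_TensorO_outer)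

text \<open>Precomposition does disturb the order: the hidden object \<open>W\<close> of
  \<open>G\<close> comes after the traced \<open>U\<close> on one side and before it on the other,
  so the two are exchanged by conjugation.\<close>

lemma D_Tr_Comp_right:
  assumes "F \<in> hom\<^bsub>D\<^esub> (X \<otimes> U) (Y \<otimes> U)" "G \<in> hom\<^bsub>D\<^esub> X' X" "Y \<in> Obj C" "U \<in> Obj C"
  shows "D_Tr X' Y U (F \<cdot>\<^bsub>D\<^esub> whiskr G U) = map_option (\<lambda>T. T \<cdot>\<^bsub>D\<^esub> G) (D_Tr X Y U F)"
proof -
  obtain V f W g where
    [simp]: "F = cls (X \<otimes> U) (Y \<otimes> U) (V, f)" "G = cls X' X (W, g)"
      "X \<in> Obj C" "X' \<in> Obj C" "V \<in> Obj C" "W \<in> Obj C"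
      "f \<in> Arr C" "Dom C f = X \<otimes> U \<otimes> V" "Cod C f = Y \<otimes> U \<otimes> V"
      "g \<in> Arr C" "Dom C g = X' \<otimes> W" "Cod C g = X \<otimes> W"
    using assms by (elim D_homE) auto
  note [simp] = assms(3,4)
  let ?h = "bypass X Y (U \<otimes> V) (U \<otimes> V) W f \<cdot> (g \<odot> \<one> (U \<otimes> V))"
  let ?k = "\<sigma> W U \<odot> \<one> V" and ?k' = "\<sigma> U W \<odot> \<one> V"
  have 1: "(\<one> X \<odot> ?k') \<cdot> (\<one> X \<odot> ?k) = \<one> (X \<otimes> W \<otimes> U \<otimes> V)"
    by (simp add: TensorA_Comp' Symm_Symm)
  have 2: "(\<one> X \<odot> ?k) \<cdot> (g \<odot> \<one> (U \<otimes> V)) \<cdot> (\<one> X' \<odot> ?k') = bypass X' X W W U g \<odot> \<one> V"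
    by (simp add: bypass_eq_right whisker_right_Comp)
  \<comment> \<open>The inserted pair of symmetries is shared out: one half regroups the bypass of
    \<open>f\<close> so that \<open>U\<close> counts as visible, the other completes the bypass of
    \<open>g\<close> along \<open>U\<close>.\<close>
  have "(\<one> Y \<odot> ?k) \<cdot> ?h \<cdot> (\<one> X' \<odot> ?k') =
      (\<one> Y \<odot> ?k) \<cdot> bypass X Y (U \<otimes> V) (U \<otimes> V) W f \<cdot> ((\<one> X \<odot> ?k') \<cdot> (\<one> X \<odot> ?k)) \<cdot> (g \<odot> \<one> (U \<otimes> V)) \<cdot> (\<one> X' \<odot> ?k')"
    unfolding 1 by simp
  also have "\<dots> = bypass (X \<otimes> U) (Y \<otimes> U) V V W f \<cdot> (bypass X' X W W U g \<odot> \<one> V)"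
    by (simp add: bypass_regroup [of f X U V Y U V W] 2)
  finally have "cls X' Y (W \<otimes> U \<otimes> V, ?h) =
      cls X' Y (U \<otimes> W \<otimes> V, bypass (X \<otimes> U) (Y \<otimes> U) V V W f \<cdot> (bypass X' X W W U g \<odot> \<one> V))"
    using trace_equiv_conjugate [of ?h X' "W \<otimes> U \<otimes> V" Y ?k "U \<otimes> W \<otimes> V" ?k']
    by (intro cls_eqI) (simp add: Symm_Symm_whisker)
  then show ?thesis
    by (simp add: whiskr_cls D_Comp D_Tr_cls)
qed

text \<open>A representative \<open>g\<close> of \<open>G\<close> carries its own hidden object
  \<open>W\<close>, so the arrow to be slid is \<open>g\<close> run past \<open>V\<close>, from
  \<open>U' \<otimes> V \<otimes> W\<close> to \<open>U \<otimes> V \<otimes> W\<close>. It is in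
  general not invertible, which is why \<open>slide\<close> admits arbitrary arrows. One side lists
  \<open>W\<close> before \<open>V\<close> and is reordered beforehand.\<close>

lemma D_Tr_dinatural:
  assumes "F \<in> hom\<^bsub>D\<^esub> (X \<otimes> U) (Y \<otimes> U')" "G \<in> hom\<^bsub>D\<^esub> U' U" "X \<in> Obj C" "Y \<in> Obj C"
  shows "D_Tr X Y U (whiskl Y G \<cdot>\<^bsub>D\<^esub> F) = D_Tr X Y U' (F \<cdot>\<^bsub>D\<^esub> whiskl X G)"
proof -
  obtain V f W g where
    [simp]: "F = cls (X \<otimes> U) (Y \<otimes> U') (V, f)" "G = cls U' U (W, g)"
      "U \<in> Obj C" "U' \<in> Obj C" "V \<in> Obj C" "W \<in> Obj C"
      "f \<in> Arr C" "Dom C f = X \<otimes> U \<otimes> V" "Cod C f = Y \<otimes> U' \<otimes> V"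
      "g \<in> Arr C" "Dom C g = U' \<otimes> W" "Cod C g = U \<otimes> W"
    using assms by (elim D_homE) auto
  note [simp] = assms(3,4)
  let ?b = "bypass U' U W W V g"
  let ?h = "bypass (X \<otimes> U) (Y \<otimes> U') V V W f \<cdot> (\<one> X \<odot> (g \<odot> \<one> V))"
  let ?k = "\<one> U' \<odot> \<sigma> W V" and ?k' = "\<one> U' \<odot> \<sigma> V W"
  have 1: "(\<one> (Y \<otimes> U') \<odot> \<sigma> W V) \<cdot> bypass (X \<otimes> U) (Y \<otimes> U') V V W f = (f \<odot> \<one> W) \<cdot> (\<one> (X \<otimes> U) \<odot> \<sigma> W V)"
    using Symm_Symm_whisker_Comp(2) [of V W "Y \<otimes> U'"] by (simp add: bypass_eq_right)
  have "(\<one> Y \<odot> ?k) \<cdot> ?h \<cdot> (\<one> X \<odot> ?k') =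
      ((\<one> (Y \<otimes> U') \<odot> \<sigma> W V) \<cdot> bypass (X \<otimes> U) (Y \<otimes> U') V V W f) \<cdot> (\<one> X \<odot> (g \<odot> \<one> V)) \<cdot> (\<one> X \<odot> ?k')"
    by simp
  also have "\<dots> = (f \<odot> \<one> W) \<cdot> (\<one> X \<odot> ?b)"
    unfolding 1 by (simp add: bypass_eq_right [of g] whisker_left_Comp)
  finally have "cls X Y (U' \<otimes> W \<otimes> V, ?h) = cls X Y (U' \<otimes> V \<otimes> W, (f \<odot> \<one> W) \<cdot> (\<one> X \<odot> ?b))"
    using trace_equiv_conjugate [of ?h X "U' \<otimes> W \<otimes> V" Y ?k "U' \<otimes> V \<otimes> W" ?k']
    by (intro cls_eqI) (simp add: Symm_Symm_whisker)
  moreover have "cls X Y (U \<otimes> V \<otimes> W, (\<one> Y \<odot> ?b) \<cdot> (f \<odot> \<one> W)) =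
      cls X Y (U' \<otimes> V \<otimes> W, (f \<odot> \<one> W) \<cdot> (\<one> X \<odot> ?b))"
    by (intro cls_eqI trace_equiv_slide) simp_all
  ultimately show ?thesis
    by (simp add: whiskl_cls D_Comp D_Tr_cls bypass_whisker_left)
qed

lemma D_Tr_whiskl:
  assumes "F \<in> hom\<^bsub>D\<^esub> (X \<otimes> U) (Y \<otimes> U)" "X \<in> Obj C" "Y \<in> Obj C" "U \<in> Obj C" "W \<in> Obj C"
  shows "D_Tr (W \<otimes> X) (W \<otimes> Y) U (whiskl W F) = map_option (whiskl W) (D_Tr X Y U F)"
proof -
  obtain V f where
    [simp]: "F = cls (X \<otimes> U) (Y \<otimes> U) (V, f)" "V \<in> Obj C"
      "f \<in> Arr C" "Dom C f = X \<otimes> U \<otimes> V" "Cod C f = Y \<otimes> U \<otimes> V"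
    using assms by (elim D_homE) auto
  show ?thesis
    using D_Tr_cls [of "W \<otimes> X" "W \<otimes> Y" U V "\<one> W \<odot> f"] assms(2-5)
    by (simp add: whiskl_cls D_Tr_cls)
qed

text \<open>The new trace only moves \<open>U\<close> into the hidden object; removing all of it,
  with \<open>\<I>\<close> as the part that stays, recovers the trace of C.\<close>

lemma D_Tr_pure:
  assumes "Tr A B U f = Some t"
  shows "D_Tr A B U (pure f) = Some (pure t)"
proof -
  have [simp]: "A \<in> Obj C" "B \<in> Obj C" "U \<in> Obj C" "f \<in> Arr C" "Dom C f = A \<otimes> U" "Cod C f = B \<otimes> U"
    "t \<in> Arr C" "Dom C t = A" "Cod C t = B"
    using Tr_partial_function [OF assms] by (auto simp: Hom_def)
  have "trace_equiv A B (\<I> \<otimes> U, f) (\<I>, t)"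
    by (rule hide) (simp_all add: assms homI)
  then show ?thesis
    by (simp add: pure_def D_Tr_cls cls_eqI)
qed

lemma partially_traced_category_D: "partially_traced_category D D_Tr"
proof
  fix X Y U F T assume *: "D_Tr X Y U F = Some T"
  then have F: "X \<in> Obj C" "Y \<in> Obj C" "U \<in> Obj C" "F \<in> hom\<^bsub>D\<^esub> (X \<otimes> U) (Y \<otimes> U)"
    by (auto simp: D_Tr_def split: if_splits)
  then obtain T' where "D_Tr X Y U F = Some T'" "T' \<in> Arr D" "Dom D T' = X" "Cod D T' = Y"
    using D_Tr_SomeE by blast
  with * have "T \<in> hom\<^bsub>D\<^esub> X Y"
    by (simp add: Hom_def)
  with F show "X \<in> Obj D \<and> Y \<in> Obj D \<and> U \<in> Obj D \<and> F \<in> hom\<^bsub>D\<^esub> (X \<otimes>\<^bsub>D\<^esub> U) (Y \<otimes>\<^bsub>D\<^esub> U) \<and> T \<in> hom\<^bsub>D\<^esub> X Y"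
    by simp
next
  fix X Y U F G X' H Y'
  assume "X \<in> Obj D" "Y \<in> Obj D" "U \<in> Obj D" "F \<in> hom\<^bsub>D\<^esub> (X \<otimes>\<^bsub>D\<^esub> U) (Y \<otimes>\<^bsub>D\<^esub> U)"
    and G: "G \<in> hom\<^bsub>D\<^esub> X' X" and H: "H \<in> hom\<^bsub>D\<^esub> Y Y'"
  then have F: "F \<in> hom\<^bsub>D\<^esub> (X \<otimes> U) (Y \<otimes> U)" and [simp]: "X \<in> Obj C" "Y \<in> Obj C" "U \<in> Obj C"
    by simp_all
  have [simp]: "G \<in> Arr D" "Dom D G = X'" "Cod D G = X" "X' \<in> Obj C"
    "H \<in> Arr D" "Dom D H = Y" "Cod D H = Y'" "Y' \<in> Obj C"
    using D.homD [OF G] D.homD [OF H] by simp_all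
  have FG: "F \<cdot>\<^bsub>D\<^esub> whiskr G U \<in> hom\<^bsub>D\<^esub> (X' \<otimes> U) (Y \<otimes> U)"
    using F by (auto simp: Hom_def)
  show "map_option (\<lambda>T. H \<cdot>\<^bsub>D\<^esub> T \<cdot>\<^bsub>D\<^esub> G) (D_Tr X Y U F)
      \<lesssim> D_Tr X' Y' U ((H \<odot>\<^bsub>D\<^esub> \<one>\<^bsub>D\<^esub> U) \<cdot>\<^bsub>D\<^esub> F \<cdot>\<^bsub>D\<^esub> (G \<odot>\<^bsub>D\<^esub> \<one>\<^bsub>D\<^esub> U))"
    by (simp add: kleene_le_def TensorA_Ident_D D_Tr_Comp_left [OF FG H] D_Tr_Comp_right [OF F G]
        option.map_comp comp_def)
next
  fix X Y U U' F G
  assume "X \<in> Obj D" "Y \<in> Obj D" "U \<in> Obj D" "U' \<in> Obj D"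
    "F \<in> hom\<^bsub>D\<^esub> (X \<otimes>\<^bsub>D\<^esub> U) (Y \<otimes>\<^bsub>D\<^esub> U')" "G \<in> hom\<^bsub>D\<^esub> U' U"
  then show "D_Tr X Y U ((\<one>\<^bsub>D\<^esub> Y \<odot>\<^bsub>D\<^esub> G) \<cdot>\<^bsub>D\<^esub> F) = D_Tr X Y U' (F \<cdot>\<^bsub>D\<^esub> (\<one>\<^bsub>D\<^esub> X \<odot>\<^bsub>D\<^esub> G))"
    using D_Tr_dinatural D.homD [of G U' U] by (simp add: TensorA_Ident_D)
next
  fix X Y F assume "X \<in> Obj D" "Y \<in> Obj D" "F \<in> hom\<^bsub>D\<^esub> (X \<otimes>\<^bsub>D\<^esub> \<I>\<^bsub>D\<^esub>) (Y \<otimes>\<^bsub>D\<^esub> \<I>\<^bsub>D\<^esub>)"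
  then have F: "F \<in> hom\<^bsub>D\<^esub> X Y" and [simp]: "X \<in> Obj C" "Y \<in> Obj C"
    by simp_all
  have "D_Tr X Y \<I> F = Some F"
    using F D_Tr_cls [of X Y \<I>] by (auto elim!: D_homE)
  then show "D_Tr X Y \<I>\<^bsub>D\<^esub> F = Some (\<rho>\<^bsub>D\<^esub> Y \<cdot>\<^bsub>D\<^esub> F \<cdot>\<^bsub>D\<^esub> inv\<^bsub>D\<^esub> (\<rho>\<^bsub>D\<^esub> X))"
    using D.homD [OF F] by simp
next
  fix X Y U V G T
  assume "X \<in> Obj D" "Y \<in> Obj D" "U \<in> Obj D" "V \<in> Obj D"
    "G \<in> hom\<^bsub>D\<^esub> ((X \<otimes>\<^bsub>D\<^esub> U) \<otimes>\<^bsub>D\<^esub> V) ((Y \<otimes>\<^bsub>D\<^esub> U) \<otimes>\<^bsub>D\<^esub> V)"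
    and T: "D_Tr (X \<otimes>\<^bsub>D\<^esub> U) (Y \<otimes>\<^bsub>D\<^esub> U) V G = Some T"
  then have G: "G \<in> hom\<^bsub>D\<^esub> (X \<otimes> U \<otimes> V) (Y \<otimes> U \<otimes> V)"
    and [simp]: "X \<in> Obj C" "Y \<in> Obj C" "U \<in> Obj C" "V \<in> Obj C"
    by simp_all
  obtain W g where
    [simp]: "G = cls (X \<otimes> U \<otimes> V) (Y \<otimes> U \<otimes> V) (W, g)" "W \<in> Obj C"
      "g \<in> Arr C" "Dom C g = X \<otimes> U \<otimes> V \<otimes> W" "Cod C g = Y \<otimes> U \<otimes> V \<otimes> W"
    using G by (elim D_homE) auto
  \<comment> \<open>One trace along \<open>U \<otimes> V\<close> and two successive ones leave the
    same \<open>g\<close> with hidden object \<open>U \<otimes> V \<otimes> W\<close>.\<close>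
  have "D_Tr X Y (U \<otimes> V) G = D_Tr X Y U T"
    using T D_Tr_cls [of "X \<otimes> U" "Y \<otimes> U" V W g] by (auto simp: D_Tr_cls)
  then show "D_Tr X Y (U \<otimes>\<^bsub>D\<^esub> V) (\<alpha>\<^bsub>D\<^esub> Y U V \<cdot>\<^bsub>D\<^esub> G \<cdot>\<^bsub>D\<^esub> inv\<^bsub>D\<^esub> (\<alpha>\<^bsub>D\<^esub> X U V)) = D_Tr X Y U T"
    using D.homD [OF G] by simp
next
  fix X Y U F G W Z
  assume "X \<in> Obj D" "Y \<in> Obj D" "U \<in> Obj D" "F \<in> hom\<^bsub>D\<^esub> (X \<otimes>\<^bsub>D\<^esub> U) (Y \<otimes>\<^bsub>D\<^esub> U)"
    and G: "G \<in> hom\<^bsub>D\<^esub> W Z"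
  then have F: "F \<in> hom\<^bsub>D\<^esub> (X \<otimes> U) (Y \<otimes> U)" and [simp]: "X \<in> Obj C" "Y \<in> Obj C" "U \<in> Obj C"
    by simp_all
  have [simp]: "G \<in> Arr D" "Dom D G = W" "Cod D G = Z" "W \<in> Obj C" "Z \<in> Obj C"
    "F \<in> Arr D" "Dom D F = X \<otimes> U" "Cod D F = Y \<otimes> U"
    using D.homD [OF G] D.homD [OF F] by simp_all
  obtain T where T [simp]: "D_Tr X Y U F = Some T" "T \<in> Arr D" "Dom D T = X" "Cod D T = Y"
    by (rule D_Tr_SomeE [OF F]) simp_all
  \<comment> \<open>The whiskering of \<open>G\<close> by \<open>X \<otimes> U\<close> is that of
    \<open>whiskr G X\<close> by \<open>U\<close>, so naturality pulls \<open>whiskr G X\<close> out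
    of the trace and only a left whiskering of \<open>F\<close> remains inside.\<close>
  have "D_Tr (W \<otimes> X) (Z \<otimes> Y) U (whiskl Z F \<cdot>\<^bsub>D\<^esub> whiskr (whiskr G X) U) =
      map_option (\<lambda>T. T \<cdot>\<^bsub>D\<^esub> whiskr G X) (D_Tr (Z \<otimes> X) (Z \<otimes> Y) U (whiskl Z F))"
    by (rule D_Tr_Comp_right) (simp_all add: Hom_def)
  then have "D_Tr (W \<otimes> X) (Z \<otimes> Y) U (G \<odot>\<^bsub>D\<^esub> F) = Some (G \<odot>\<^bsub>D\<^esub> T)"
    by (simp add: D_TensorA D_Tr_whiskl [OF F])
  moreover have "G \<odot>\<^bsub>D\<^esub> F \<in> Arr D" "Dom D (G \<odot>\<^bsub>D\<^esub> F) = W \<otimes> X \<otimes> U" "Cod D (G \<odot>\<^bsub>D\<^esub> F) = Z \<otimes> Y \<otimes> U"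
    by (simp_all add: D_TensorA)
  ultimately show "map_option (\<lambda>T. G \<odot>\<^bsub>D\<^esub> T) (D_Tr X Y U F)
      \<lesssim> D_Tr (W \<otimes>\<^bsub>D\<^esub> X) (Z \<otimes>\<^bsub>D\<^esub> Y) U (inv\<^bsub>D\<^esub> (\<alpha>\<^bsub>D\<^esub> Z Y U) \<cdot>\<^bsub>D\<^esub> (G \<odot>\<^bsub>D\<^esub> F) \<cdot>\<^bsub>D\<^esub> \<alpha>\<^bsub>D\<^esub> W X U)"
    by (simp add: kleene_le_def)
next
  fix U assume "U \<in> Obj D"
  then show "D_Tr U U U (\<sigma>\<^bsub>D\<^esub> U U) = Some (\<one>\<^bsub>D\<^esub> U)"
    by (simp add: D_Symm D_Ident D_Tr_pure yanking)
qed

lemma totally_traced_category_D: "totally_traced_category D D_Tr"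
  by (intro totally_traced_category.intro totally_traced_category_axioms.intro partially_traced_category_D)
    (simp add: D_Tr_def)

section \<open>The embedding: a faithful strong symmetric monoidal functor\<close>

lemma pure_functor: "strong_symmetric_monoidal_functor C D (\<lambda>A. A) pure (\<lambda>A B. \<one>\<^bsub>D\<^esub> (A \<otimes> B)) (\<one>\<^bsub>D\<^esub> \<I>)"
proof
  fix f A B assume "f \<in> hom A B"
  then show "pure f \<in> hom\<^bsub>D\<^esub> A B"
    by (auto simp: Hom_def)
next
  fix f g A B E assume "f \<in> hom A B" "g \<in> hom B E"
  then show "pure (g \<cdot> f) = pure g \<cdot>\<^bsub>D\<^esub> pure f"
    by (auto simp: Hom_def pure_Comp)
next
  fix f g A A' B B' assume "f \<in> hom A A'" "g \<in> hom B B'"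
  then show "\<one>\<^bsub>D\<^esub> (A' \<otimes> B') \<cdot>\<^bsub>D\<^esub> (pure f \<odot>\<^bsub>D\<^esub> pure g) = pure (f \<odot> g) \<cdot>\<^bsub>D\<^esub> \<one>\<^bsub>D\<^esub> (A \<otimes> B)"
    by (auto dest!: homD simp: pure_TensorA)
qed (simp_all add: D.Ident_hom D.is_iso_Ident D_Symm D_Ident [symmetric])

lemma faithful_pure: "faithful C pure"
  unfolding faithful_def
proof (intro ballI inj_onI)
  fix A B f g assume "A \<in> Obj C" "B \<in> Obj C" and f: "f \<in> hom A B" and g: "g \<in> hom A B"
    and "pure f = pure g"
  then have "trace_equiv A B (\<I>, f) (\<I>, g)"
    by (intro cls_eqD) (auto simp: pure_def dest!: homD)
  then have "Tr A B \<I> f = Tr A B \<I> g"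
    using trace_equiv_Tr homD [OF f] by fastforce
  then show "f = g"
    using vanishing_I [of A B] homD [OF f] homD [OF g] f g by simp
qed

end

theorem theorem5p7p1:
  fixes C :: "('o, 'a) smc"
    and Tr :: "'o \<Rightarrow> 'o \<Rightarrow> 'o \<Rightarrow> 'a \<Rightarrow> 'a option"
  assumes "strict_symmetric_monoidal_category C"
    and "partially_traced_category C Tr"
  shows "\<exists>(D :: ('o, ('o, 'a) ambient_arrow) smc) TrD FO FA m e.
           totally_traced_category D TrD \<and>
           strong_symmetric_monoidal_functor C D FO FA m e \<and>
           faithful C FA \<and>
           (\<forall>A \<in> Obj C. \<forall>B \<in> Obj C. \<forall>U \<in> Obj C.
              \<forall>f \<in> hom\<^bsub>C\<^esub> (A \<otimes>\<^bsub>C\<^esub> U) (B \<otimes>\<^bsub>C\<^esub> U). \<forall>t.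
                Tr A B U f = Some t \<longrightarrow>
                TrD (FO A) (FO B) (FO U) (inv\<^bsub>D\<^esub> (m B U) \<cdot>\<^bsub>D\<^esub> FA f \<cdot>\<^bsub>D\<^esub> m A U) = Some (FA t))"
proof -
  interpret strict_partially_traced C Tr
    by (intro strict_partially_traced.intro assms)
  have "D_Tr A B U (inv\<^bsub>D\<^esub> (\<one>\<^bsub>D\<^esub> (B \<otimes>\<^bsub>C\<^esub> U)) \<cdot>\<^bsub>D\<^esub> pure f \<cdot>\<^bsub>D\<^esub> \<one>\<^bsub>D\<^esub> (A \<otimes>\<^bsub>C\<^esub> U)) = Some (pure t)"
    if "A \<in> Obj C" "B \<in> Obj C" "U \<in> Obj C" "f \<in> hom\<^bsub>C\<^esub> (A \<otimes>\<^bsub>C\<^esub> U) (B \<otimes>\<^bsub>C\<^esub> U)" "Tr A B U f = Some t"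
    for A B U f t
    using that by (auto dest!: homD simp: D_Tr_pure)
  then show ?thesis
    using totally_traced_category_D pure_functor faithful_pure
    by (intro exI [of _ D] exI [of _ D_Tr] exI [of _ "\<lambda>A. A"] exI [of _ pure]
        exI [of _ "\<lambda>A B. \<one>\<^bsub>D\<^esub> (A \<otimes>\<^bsub>C\<^esub> B)"] exI [of _ "\<one>\<^bsub>D\<^esub> \<I>\<^bsub>C\<^esub>"]) blast
qed

end
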